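(* Let $A\in\mathbb{N}_0$, write $\mathbb{N}_A:=\{A,A+1,A+2,\dots\}$, and let $f:\mathbb{N}_0\to\mathbb{N}_A$ be surjective and monotonically increasing (non-decreasing). For integers $k$ define $F(k):=\#\{n\in\mathbb{N}_0: f(n)=k\}$ (so $F(k)=0$ for $k<A$). Assume that $F(k)$ is monotonically increasing in $k$ for all sufficiently large $k$. Then: (1) For an arbitrary sequence $(\boldsymbol{x}_n)_{n\ge0}$ in $[0,1)^s$ and every $N\in\mathbb{N}$, $$\frac{F(f(N)-1)}{N}\le D_N((\boldsymbol{x}_{f(n)})_{n\ge0}).$$ (2) For a Halton-sequence $(\boldsymbol{x}_n)_{n\ge0}$ in co-prime bases $b_1,\dots,b_s$ there is a constant $C$ independent of $N$ such that for all integers $N\ge2$ $$D_N((\boldsymbol{x}_{f(n)})_{n\ge0})\le C\,\frac{2F(f(N-1)+1)(\log N)^s}{N}.$$ (3) For a digital $(t,s)$-sequence $(\boldsymbol{x}_n)_{n\ge0}$ over $\mathbb{F}_p$, $p$ prime, there is a constant $\widetilde{C}$ independent of $N$ such that for all integers $N\ge2$ $$D_N((\boldsymbol{x}_{f(n)})_{n\ge0})\le\widetilde{C}\,p^t\,\frac{2F(f(N-1)+1)(\log N)^s}{N}.$$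
   Context: Discrepancy of a sequence $(\boldsymbol{y}_n)_{n\ge0}$ in $[0,1)^s$ (points counted with multiplicity): $D_N:=\sup_{[\boldsymbol{a},\boldsymbol{b})\subseteq[0,1)^s}|\#\{0\le n<N:\boldsymbol{y}_n\in[\boldsymbol{a},\boldsymbol{b})\}/N-\mathrm{vol}([\boldsymbol{a},\boldsymbol{b}))|$. Halton-sequence: $\boldsymbol{x}_n=(\varphi_{b_1}(n),\dots,\varphi_{b_s}(n))$ where, for $n=a_0+a_1b+\cdots$ in base $b$, $\varphi_b(n)=a_0/b+a_1/b^2+\cdots$. Digital $(t,s)$-sequence over $\mathbb{F}_p$ (elements of $\mathbb{F}_p$ identified with $\{0,\dots,p-1\}$): choose $\mathbb{N}\times\mathbb{N}$ matrices $C_1,\dots,C_s$ over $\mathbb{F}_p$ such that for every $m\ge t$ and all $d_1,\dots,d_s\in\mathbb{N}_0$ with $d_1+\cdots+d_s=m-t$, the vectors consisting of the first $m$ entries of the first $d_1$ rows of $C_1$, …, the first $d_s$ rows of $C_s$ are linearly independent in $\mathbb{F}_p^m$, and such that for each $j$ and each column $w$ the entries $c^{(j)}_{v,w}$ vanish for all sufficiently large $v$. For $n=n_0+n_1p+\cdots$ in base $p$, compute $C_j(n_0,n_1,\dots)^\top=(x_{n,j}(1),x_{n,j}(2),\dots)^\top$ over $\mathbb{F}_p$ and set $x_n^{(j)}=\sum_{i\ge1}x_{n,j}(i)p^{-i}$, $\boldsymbol{x}_n=(x_n^{(1)},\dots,x_n^{(s)})$. *)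

theory Defs
  imports "HOL-Analysis.Analysis" "HOL-Computational_Algebra.Primes"
begin

(* The order on real ^ 's is componentwise with a < b meaning a \<le> b and a \<noteq> b,
   so the library interval {a..<b} is not the half-open box. *)
definition half_open_box :: "real ^ 's \<Rightarrow> real ^ 's \<Rightarrow> (real ^ 's) set" where
  "half_open_box a b = {y. \<forall>i. a $ i \<le> y $ i \<and> y $ i < b $ i}"

definition unit_cube :: "(real ^ 's) set" where
  "unit_cube = half_open_box 0 1"

definition discrepancy :: "nat \<Rightarrow> (nat \<Rightarrow> real ^ 's) \<Rightarrow> real" where
  "discrepancy N y =
     (SUP (a, b) \<in> {(a, b). half_open_box a b \<subseteq> unit_cube}.
        \<bar>real (card {n. n < N \<and> y n \<in> half_open_box a b}) / real N
          - measure lborel (half_open_box a b)\<bar>)"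

(* k ranges over the integers: the statement uses k = f N - 1, and f N may be 0. *)
definition level_count :: "(nat \<Rightarrow> nat) \<Rightarrow> int \<Rightarrow> nat" where
  "level_count f k = card {n. int (f n) = k}"

definition digit :: "nat \<Rightarrow> nat \<Rightarrow> nat \<Rightarrow> nat" where
  "digit b n i = n div b ^ i mod b"

definition radical_inverse :: "nat \<Rightarrow> nat \<Rightarrow> real" where
  "radical_inverse b n = (\<Sum>i. real (digit b n i) / real b ^ Suc i)"

definition halton :: "('s \<Rightarrow> nat) \<Rightarrow> nat \<Rightarrow> real ^ 's" where
  "halton b n = (\<chi> j. radical_inverse (b j) n)"

(* Elements of the field with p elements are represented by {0..<p} with arithmetic modulo p.
   Rows v and columns w of the matrices are numbered from 0, so the first d rows are those
   with v < d.  Linear independence is that of the family of rows (not merely of the set). *)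
definition digital_ts_matrices ::
  "nat \<Rightarrow> nat \<Rightarrow> ('s::finite \<Rightarrow> nat \<Rightarrow> nat \<Rightarrow> nat) \<Rightarrow> bool" where
  "digital_ts_matrices p t C \<longleftrightarrow>
     (\<forall>j v w. C j v w < p) \<and>
     (\<forall>m d. t \<le> m \<longrightarrow> (\<Sum>j\<in>UNIV. d j) = m - t \<longrightarrow>
        (\<forall>c :: 's \<Rightarrow> nat \<Rightarrow> nat.
           (\<forall>j. \<forall>v<d j. c j v < p) \<longrightarrow>
           (\<forall>w<m. (\<Sum>j\<in>UNIV. \<Sum>v<d j. c j v * C j v w) mod p = 0) \<longrightarrow>
           (\<forall>j. \<forall>v<d j. c j v = 0))) \<and>
     (\<forall>j w. \<forall>\<^sub>F v in sequentially. C j v w = 0)"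

(* The sum over all columns is restricted to the finitely many nonzero digits of n. *)
definition digital_digit :: "nat \<Rightarrow> (nat \<Rightarrow> nat \<Rightarrow> nat) \<Rightarrow> nat \<Rightarrow> nat \<Rightarrow> nat" where
  "digital_digit p M n v = (\<Sum>w | digit p n w \<noteq> 0. M v w * digit p n w) mod p"

definition digital_sequence ::
  "nat \<Rightarrow> ('s \<Rightarrow> nat \<Rightarrow> nat \<Rightarrow> nat) \<Rightarrow> nat \<Rightarrow> real ^ 's" where
  "digital_sequence p C n = (\<chi> j. \<Sum>i. real (digital_digit p (C j) n i) / real p ^ Suc i)"

definition digital_ts_sequence :: "nat \<Rightarrow> nat \<Rightarrow> (nat \<Rightarrow> real ^ 's::finite) \<Rightarrow> bool" where
  "digital_ts_sequence p t x \<longleftrightarrow> (\<exists>C. digital_ts_matrices p t C \<and> x = digital_sequence p C)"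

end

theory Submission
  imports Defs "HOL-Number_Theory.Cong"
begin

text \<open>
  Both kinds of sequences hit every elementary interval, a product of intervals
  \<open>[a\<^sub>j / b\<^sub>j\<^sup>d, (a\<^sub>j + 1) / b\<^sub>j\<^sup>d)\<close> with \<open>d = d\<^sub>j\<close>, with the expected frequency up to a bounded
  error: for Halton sequences by the Chinese remainder theorem, for digital sequences because
  linearly independent forms over the field with \<open>p\<close> elements are equidistributed. An arbitrary
  box is squeezed between two boxes with vertices on a grid of mesh about \<open>1/N\<close>, each a disjoint
  union of \<open>O((log N)\<^sup>s)\<close> elementary intervals, so the unnormalised local discrepancy of the first
  \<open>k \<le> N\<close> points is \<open>O((log N)\<^sup>s)\<close>. Passing to the sequence indexed by \<open>f\<close> repeats the \<open>k\<close>-th point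
  \<open>F k\<close> times, and summation by parts costs a factor equal to the total variation of \<open>F\<close>, which
  is \<open>O(F M)\<close> on \<open>{0..M}\<close> as \<open>F\<close> is eventually monotone. For the lower bound, a tiny box around the
  point with index \<open>f N - 1\<close> contains \<open>F (f N - 1)\<close> of the first \<open>N\<close> points.
\<close>

subsection \<open>Counting in blocks and digit expansions\<close>

text \<open>Complete blocks of length \<open>Q\<close> are counted exactly. Only the last,
  incomplete block causes an error, and there both the true and the expected count lie between 0 and
  \<open>R\<close>.\<close>

lemma block_count_error:
  fixes P :: "nat \<Rightarrow> bool"
  assumes Q: "Q > 0" and blk: "\<And>k. card {n. n < Q \<and> P (k * Q + n)} = R"
  shows "\<bar>real (card {n. n < N \<and> P n}) - real N * real R / real Q\<bar> \<le> real R"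
proof -
  have whole: "card {n. n < k * Q + r \<and> P n} = k * R + card {n. n < r \<and> P (k * Q + n)}"
    for k r
  proof (induction k arbitrary: r)
    case 0
    then show ?case by simp
  next
    case (Suc k)
    have split: "{n. n < Suc k * Q + r \<and> P n} =
        {n. n < k * Q + Q \<and> P n} \<union> (\<lambda>n. Suc k * Q + n) ` {n. n < r \<and> P (Suc k * Q + n)}"
    proof (intro set_eqI iffI)
      fix n assume n: "n \<in> {n. n < Suc k * Q + r \<and> P n}"
      show "n \<in> {n. n < k * Q + Q \<and> P n} \<union> (\<lambda>n. Suc k * Q + n) ` {n. n < r \<and> P (Suc k * Q + n)}"
      proof (cases "n < Suc k * Q")
        case False
        then show ?thesis using n
          by (intro UnI2 image_eqI[of _ _ "n - Suc k * Q"]) auto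
      qed (use n in auto)
    qed auto
    have "card {n. n < Suc k * Q + r \<and> P n} =
        card {n. n < k * Q + Q \<and> P n} + card ((\<lambda>n. Suc k * Q + n) ` {n. n < r \<and> P (Suc k * Q + n)})"
      unfolding split by (rule card_Un_disjoint) auto
    \<comment> \<open>The induction hypothesis holds for arbitrary \<open>r\<close>; taking
      \<open>r = Q\<close> adds one more complete block.\<close>
    also have "card {n. n < k * Q + Q \<and> P n} = k * R + R"
      using Suc[of Q] blk by simp
    finally show ?case by (simp add: card_image)
  qed
  define k r where "k = N div Q" and "r = N mod Q"
  have N: "N = k * Q + r" and r: "r < Q" using Q by (auto simp: k_def r_def)
  define c where "c = card {n. n < r \<and> P (k * Q + n)}"
  have "c \<le> card {n. n < Q \<and> P (k * Q + n)}"
    unfolding c_def by (rule card_mono) (use r in auto)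
  then have "c \<le> R" using blk by simp
  moreover have "real N * real R / real Q = k * R + r * R / Q"
    using Q by (simp add: N field_simps)
  moreover have "real r * real R \<le> real Q * real R"
    using r by (intro mult_right_mono) auto
  then have "r * R / Q \<le> real R"
    using Q by (simp add: pos_divide_le_eq mult.commute)
  moreover have "r * R / Q \<ge> 0" by simp
  ultimately show ?thesis
    unfolding N whole c_def[symmetric] by (simp only: abs_le_iff of_nat_add of_nat_mult) linarith
qed

text \<open>The common form of radical inverses and of the coordinates of digital sequences;
  \<open>g 0\<close> is the leading digit after the point.\<close>

definition digit_value :: "nat \<Rightarrow> (nat \<Rightarrow> nat) \<Rightarrow> real" where
  "digit_value b g = (\<Sum>i. real (g i) / real b ^ Suc i)"

lemma summable_digit_value:
  assumes "\<forall>\<^sub>F i in sequentially. g i = (0::nat)"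
  shows "summable (\<lambda>i. real (g i) / real b ^ Suc i)"
proof -
  have "\<forall>\<^sub>F i in sequentially. real (g i) / real b ^ Suc i = 0"
    using assms by eventually_elim auto
  then show ?thesis using summable_cong by fastforce
qed

text \<open>Splitting off the leading digit is the recursion behind the inductions that
  follow.\<close>

lemma digit_value_shift:
  assumes "\<forall>\<^sub>F i in sequentially. g i = (0::nat)"
  shows "digit_value b g = (real (g 0) + digit_value b (\<lambda>i. g (Suc i))) / real b"
proof -
  have sh: "\<forall>\<^sub>F i in sequentially. g (Suc i) = (0::nat)"
    using assms by (rule eventually_sequentially_Suc[of "\<lambda>i. g i = 0", THEN iffD2])
  have "digit_value b g = (\<Sum>i. real (g (Suc i)) / real b ^ Suc (Suc i)) + real (g 0) / b"
    using suminf_split_head[OF summable_digit_value[OF assms, of b]]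
    by (simp add: digit_value_def)
  also have "(\<Sum>i. real (g (Suc i)) / real b ^ Suc (Suc i)) = digit_value b (\<lambda>i. g (Suc i)) / b"
    using suminf_divide[OF summable_digit_value[OF sh, of b], of "real b"]
    by (simp add: digit_value_def mult.commute)
  finally show ?thesis by (simp add: add_divide_distrib)
qed

text \<open>Induction on an index from which all digits vanish. The strict upper bound rests on this
  finiteness: an expansion with all digits \<open>b - 1\<close> would have value 1.\<close>

lemma digit_value_bounds:
  assumes "\<And>i. g i < b" and "\<forall>\<^sub>F i in sequentially. g i = (0::nat)"
  shows "0 \<le> digit_value b g \<and> digit_value b g < 1"
proof -
  obtain K where "\<forall>i\<ge>K. g i = 0" using assms(2) by (auto simp: eventually_sequentially)
  then show ?thesis using assms(1)
  proof (induction K arbitrary: g)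
    case 0
    then have "digit_value b g = 0" by (simp add: digit_value_def)
    then show ?case by simp
  next
    case (Suc K)
    have ev: "\<forall>\<^sub>F i in sequentially. g i = (0::nat)"
      using Suc.prems(1) by (auto simp: eventually_sequentially)
    have IH: "0 \<le> digit_value b (\<lambda>i. g (Suc i))" "digit_value b (\<lambda>i. g (Suc i)) < 1"
      using Suc.IH[of "\<lambda>i. g (Suc i)"] Suc.prems by auto
    have "g 0 + 1 \<le> b" using Suc.prems(2)[of 0] by simp
    then have "real (g 0) + 1 \<le> real b" by linarith
    then show ?case
      unfolding digit_value_shift[OF ev, of b] using IH by (simp add: field_simps)
  qed
qed

text \<open>The witness \<open>e\<close> lists the base \<open>b\<close> digits of \<open>a\<close>,
  most significant first: the cells of level \<open>d\<close> are exactly the sets of expansions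
  with \<open>d\<close> prescribed leading digits.\<close>

lemma floor_digit_value_eq_iff:
  assumes "a < b ^ d" "b > 0"
  shows "\<exists>e. (\<forall>i<d. e i < b) \<and> (\<forall>g. (\<forall>i. g i < b) \<longrightarrow> (\<forall>\<^sub>F i in sequentially. g i = 0) \<longrightarrow>
     (\<lfloor>real b ^ d * digit_value b g\<rfloor> = int a \<longleftrightarrow> (\<forall>i<d. g i = e i)))"
  using assms(1)
proof (induction d arbitrary: a)
  case 0
  then show ?case using digit_value_bounds by (auto simp: floor_eq_iff)
next
  case (Suc d)
  define q r where "q = a div b ^ d" and "r = a mod b ^ d"
  have a: "a = q * b ^ d + r" and r: "r < b ^ d" using assms(2) by (simp_all only: q_def r_def div_mult_mod_eq) auto
  have q: "q < b" using Suc.prems by (simp add: q_def less_mult_imp_div_less)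
  obtain e where e: "\<And>i. i < d \<Longrightarrow> e i < b"
    "\<And>g. \<lbrakk>\<forall>i. g i < b; \<forall>\<^sub>F i in sequentially. g i = 0\<rbrakk> \<Longrightarrow>
     \<lfloor>real b ^ d * digit_value b g\<rfloor> = int r \<longleftrightarrow> (\<forall>i<d. g i = e i)"
    using Suc.IH[OF r] by blast
  show ?case
  proof (intro exI[of _ "case_nat q e"] conjI allI impI)
    fix i assume "i < Suc d"
    then show "(case i of 0 \<Rightarrow> q | Suc x \<Rightarrow> e x) < b" using q e(1) by (cases i) auto
  next
    fix g assume g: "\<forall>i. g i < b" "\<forall>\<^sub>F i in sequentially. g i = 0"
    define v where "v = digit_value b (\<lambda>i. g (Suc i))"
    have ev: "\<forall>\<^sub>F i in sequentially. g (Suc i) = (0::nat)"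
      using g(2) by (rule eventually_sequentially_Suc[of "\<lambda>i. g i = 0", THEN iffD2])
    have v: "0 \<le> v" "v < 1" unfolding v_def using digit_value_bounds[OF _ ev] g(1) by auto
    \<comment> \<open>Scaling makes the leading digit an integer summand, so the floor acts on the
      tail \<open>v\<close> alone. Uniqueness of quotient and remainder modulo \<open>b ^ d\<close>
      then separates the leading digit from the rest.\<close>
    have "real b ^ Suc d * digit_value b g = real (g 0 * b ^ d) + real b ^ d * v"
      unfolding digit_value_shift[OF g(2), of b] v_def using assms(2) by (simp add: field_simps)
    then have fl: "\<lfloor>real b ^ Suc d * digit_value b g\<rfloor> = int (g 0 * b ^ d) + \<lfloor>real b ^ d * v\<rfloor>"
      by (metis floor_add_int add.commute of_int_of_nat_eq)
    have "real b ^ d * v < real b ^ d" using v assms(2) by simp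
    then have "\<lfloor>real b ^ d * v\<rfloor> < int (b ^ d)" by (simp add: floor_less_iff)
    moreover have "\<lfloor>real b ^ d * v\<rfloor> \<ge> 0" using v by simp
    ultimately obtain u where u: "\<lfloor>real b ^ d * v\<rfloor> = int u" "u < b ^ d"
      by (metis int_nat_eq nat_less_iff of_nat_less_iff)
    have "\<lfloor>real b ^ Suc d * digit_value b g\<rfloor> = int a \<longleftrightarrow> g 0 * b ^ d + u = q * b ^ d + r"
      unfolding fl u a by linarith
    also have "\<dots> \<longleftrightarrow> g 0 = q \<and> u = r"
    proof
      assume eq: "g 0 * b ^ d + u = q * b ^ d + r"
      have "g 0 = (g 0 * b ^ d + u) div b ^ d" using u(2) assms(2) by simp
      also have "\<dots> = q" unfolding eq using r assms(2) by simp
      finally show "g 0 = q \<and> u = r" using eq by simp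
    qed simp
    also have "u = r \<longleftrightarrow> (\<forall>i<d. g (Suc i) = e i)"
      using e(2)[of "\<lambda>i. g (Suc i)"] g(1) ev u(1) by (simp add: v_def)
    also have "g 0 = q \<and> (\<forall>i<d. g (Suc i) = e i) \<longleftrightarrow> (\<forall>i<Suc d. g i = case_nat q e i)"
      by (auto simp: less_Suc_eq_0_disj)
    finally show "\<lfloor>real b ^ Suc d * digit_value b g\<rfloor> = int a \<longleftrightarrow>
        (\<forall>i<Suc d. g i = case_nat q e i)" .
  qed
qed

section \<open>Digits and residues of natural numbers\<close>

lemma digit_less: "b > 0 \<Longrightarrow> digit b n i < b"
  by (simp add: digit_def)

lemma less_power_self: "2 \<le> b \<Longrightarrow> n < (b::nat) ^ n"
  by (rule power_gt_expt) simp

lemma digit_eq_0: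
  assumes "2 \<le> b" "n \<le> i"
  shows "digit b n i = 0"
proof -
  have "n < b ^ n" using assms less_power_self by simp
  also have "\<dots> \<le> b ^ i" using assms by (intro power_increasing) auto
  finally show ?thesis by (simp add: digit_def)
qed

lemma digit_eventually_0: "2 \<le> b \<Longrightarrow> \<forall>\<^sub>F i in sequentially. digit b n i = 0"
  using digit_eq_0 by (auto simp: eventually_sequentially)

text \<open>The residue \<open>r\<close> is the number whose base \<open>b\<close> digits are
  \<open>e 0, ..., e (d - 1)\<close>. Prescribing leading digits of a radical inverse thus becomes a
  congruence for the index.\<close>

lemma mod_power_eq_iff_digits:
  assumes "\<And>i. i < d \<Longrightarrow> e i < b" "b > 0"
  shows "\<exists>r<b ^ d. \<forall>n. (\<forall>i<d. digit b n i = e i) \<longleftrightarrow> n mod b ^ d = r"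
  using assms(1)
proof (induction d)
  case 0
  then show ?case by auto
next
  case (Suc d)
  then obtain r where r: "r < b ^ d" "\<And>n. (\<forall>i<d. digit b n i = e i) \<longleftrightarrow> n mod b ^ d = r"
    by auto
  have e: "e d < b" using Suc.prems by simp
  have "(\<forall>i<Suc d. digit b n i = e i) \<longleftrightarrow> n mod b ^ Suc d = b ^ d * e d + r" for n
  proof -
    have m: "n mod b ^ Suc d = b ^ d * digit b n d + n mod b ^ d"
      unfolding power_Suc2 by (simp add: digit_def mod_mult2_eq)
    have "(\<forall>i<Suc d. digit b n i = e i) \<longleftrightarrow> digit b n d = e d \<and> n mod b ^ d = r"
      using r(2) by (auto simp: less_Suc_eq)
    also have "\<dots> \<longleftrightarrow> b ^ d * digit b n d + n mod b ^ d = b ^ d * e d + r"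
    proof
      assume eq: "b ^ d * digit b n d + n mod b ^ d = b ^ d * e d + r"
      have "digit b n d = (b ^ d * digit b n d + n mod b ^ d) div b ^ d"
        using assms(2) by simp
      also have "\<dots> = e d" unfolding eq using r(1) assms(2) by (simp add: mult.commute)
      finally show "digit b n d = e d \<and> n mod b ^ d = r" using eq by simp
    qed simp
    finally show ?thesis using m by simp
  qed
  moreover have "b ^ d * e d + r < b ^ Suc d"
  proof -
    have "b ^ d * e d + r < b ^ d * (e d + 1)" using r(1) by simp
    also have "\<dots> \<le> b ^ d * b" using e by (intro mult_left_mono) auto
    finally show ?thesis by (simp add: mult.commute)
  qed
  ultimately show ?case by blast
qed

subsection \<open>Boxes and elementary intervals\<close>

lemma prod_of_bool: "finite A \<Longrightarrow> (\<Prod>x\<in>A. of_bool (P x) :: real) = of_bool (\<forall>x\<in>A. P x)"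
  by (induction A rule: finite_induct) auto

lemma card_eq_sum_of_bool:
  fixes N :: nat
  shows "real (card {n. n < N \<and> P n}) = (\<Sum>n<N. of_bool (P n))"
proof -
  have "(\<Sum>n<N. of_bool (P n) :: real) = (\<Sum>n | n < N \<and> P n. 1)"
    by (rule sum.mono_neutral_cong_right[OF finite_lessThan]) auto
  then show ?thesis by simp
qed

text \<open>The only property of the two kinds of sequences that the discrepancy estimate uses
  besides lying in the unit cube. The floor condition says that \<open>x n\<close> lies in the
  elementary interval with levels \<open>d\<close> and positions \<open>a\<close>; the error
  \<open>R\<close> is uniform in \<open>d\<close>, \<open>a\<close> and \<open>N\<close>.\<close>

definition elementary_count_bound :: "('s::finite \<Rightarrow> nat) \<Rightarrow> real \<Rightarrow> (nat \<Rightarrow> real ^ 's) \<Rightarrow> bool" where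
  "elementary_count_bound b R x \<longleftrightarrow>
     (\<forall>d a N. (\<forall>j. a j < b j ^ d j) \<longrightarrow>
        \<bar>real (card {n. n < N \<and> (\<forall>j. \<lfloor>real (b j) ^ d j * x n $ j\<rfloor> = int (a j))})
           - real N / (\<Prod>j\<in>UNIV. real (b j) ^ d j)\<bar> \<le> R)"

lemma elementary_count_boundD:
  assumes "elementary_count_bound b R x" "\<And>j. a j < b j ^ d j"
  shows "\<bar>real (card {n. n < N \<and> (\<forall>j. \<lfloor>real (b j) ^ d j * x n $ j\<rfloor> = int (a j))})
           - real N / (\<Prod>j\<in>UNIV. real (b j) ^ d j)\<bar> \<le> R"
  using assms unfolding elementary_count_bound_def by blast

text \<open>A pair \<open>(d, a)\<close> stands for the cell
  \<open>[a / b^d, (a + 1) / b^d)\<close>. Disjointness and covering are expressed together as an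
  identity of indicators, so that products over the coordinates can be multiplied out. The bound
  \<open>d \<le> L\<close> serves the induction: cells added at level \<open>Suc L\<close> differ
  from all earlier ones.\<close>

lemma interval_elementary_decomposition:
  fixes b L u v :: nat
  assumes b: "b > 0" and v: "v \<le> b ^ L"
  shows "\<exists>S. finite S \<and> card S \<le> 2 * b * L + 1 \<and> (\<forall>(d, a)\<in>S. a < b ^ d) \<and>
     (\<forall>y::real. 0 \<le> y \<longrightarrow> y < 1 \<longrightarrow>
        (of_bool (nat \<lfloor>real b ^ L * y\<rfloor> \<in> {u..<v}) :: real) =
          (\<Sum>(d, a)\<in>S. of_bool (nat \<lfloor>real b ^ d * y\<rfloor> = a))) \<and>
     real (card {u..<v}) / real b ^ L = (\<Sum>(d, a)\<in>S. 1 / real b ^ d) \<and>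
     (\<forall>(d, a)\<in>S. d \<le> L)"
  using v
proof (induction L arbitrary: u v)
  case 0
  show ?case
  proof (cases "u = 0 \<and> v = 1")
    case True
    then show ?thesis by (intro exI[of _ "{(0, 0)}"]) (auto simp: floor_eq_iff)
  next
    case False
    then have "{u..<v} = {}" using 0 by auto
    then show ?thesis by (intro exI[of _ "{}"]) auto
  qed
next
  case (Suc L)
  \<comment> \<open>Round \<open>u\<close> up and \<open>v\<close> down to multiples of \<open>b\<close>: the core is handled one level higher, and
    fewer than \<open>2 b\<close> cells are left over.  If \<open>v' \<le> u'\<close>, everything is left over.\<close>
  define u' v' where "u' = (u + b - 1) div b" and "v' = v div b"
  have u'1: "u \<le> u' * b" and u'2: "u' * b < u + b"
  proof -
    have "(u + b - 1) mod b < b" "u' * b + (u + b - 1) mod b = u + b - 1"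
      using b by (auto simp: u'_def)
    then show "u \<le> u' * b" "u' * b < u + b" using b by linarith+
  qed
  have v'1: "v' * b \<le> v" and v'2: "v < v' * b + b"
  proof -
    have "v mod b < b" "v' * b + v mod b = v" using b by (auto simp: v'_def)
    then show "v' * b \<le> v" "v < v' * b + b" by linarith+
  qed
  have "v' * b \<le> b ^ L * b" using v'1 Suc.prems unfolding power_Suc2 by (rule le_trans)
  then have "v' \<le> b ^ L" using b by (metis mult_le_cancel2)
  from Suc.IH[OF this, of u'] obtain S where S: "finite S" "card S \<le> 2 * b * L + 1"
    "\<forall>(d, a)\<in>S. a < b ^ d" "\<forall>(d, a)\<in>S. d \<le> L"
    "\<forall>y::real. 0 \<le> y \<longrightarrow> y < 1 \<longrightarrow> (of_bool (nat \<lfloor>real b ^ L * y\<rfloor> \<in> {u'..<v'}) :: real) =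
          (\<Sum>(d, a)\<in>S. of_bool (nat \<lfloor>real b ^ d * y\<rfloor> = a))"
    "real (card {u'..<v'}) / real b ^ L = (\<Sum>(d, a)\<in>S. 1 / real b ^ d)"
    by (elim exE conjE) (rule that)
  define T where "T = {u..<v} - {u' * b..<v' * b}"
  have T: "finite T" by (simp add: T_def)
  have "T \<subseteq> {u..<u' * b} \<union> {v' * b..<v}" by (auto simp: T_def)
  then have "card T \<le> card ({u..<u' * b} \<union> {v' * b..<v})" by (intro card_mono) auto
  also have "\<dots> \<le> card {u..<u' * b} + card {v' * b..<v}" by (rule card_Un_le)
  also have "\<dots> \<le> 2 * b" using u'2 v'2 by simp
  finally have cardT: "card T \<le> 2 * b" .
  have sub: "{u' * b..<v' * b} \<subseteq> {u..<v}" using u'1 v'1 by auto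
  have disj: "S \<inter> Pair (Suc L) ` T = {}" using S(4) by fastforce
  have sum_eq: "(\<Sum>z\<in>S \<union> Pair (Suc L) ` T. h z) = (\<Sum>z\<in>S. h z) + (\<Sum>a\<in>T. h (Suc L, a))"
    for h :: "nat \<times> nat \<Rightarrow> real"
    using S(1) T disj by (simp add: sum.union_disjoint sum.reindex inj_on_def)
  show ?case
  proof (intro exI[of _ "S \<union> Pair (Suc L) ` T"] conjI allI impI)
    show "finite (S \<union> Pair (Suc L) ` T)" using S(1) T by simp
    have "card (S \<union> Pair (Suc L) ` T) \<le> card S + card (Pair (Suc L) ` T)" by (rule card_Un_le)
    also have "\<dots> \<le> card S + card T" using T by (simp add: card_image_le)
    also have "\<dots> \<le> 2 * b * Suc L + 1" using S(2) cardT by simp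
    finally show "card (S \<union> Pair (Suc L) ` T) \<le> 2 * b * Suc L + 1" .
    show "\<forall>(d, a)\<in>S \<union> Pair (Suc L) ` T. a < b ^ d"
      using S(3) Suc.prems by (auto simp: T_def)
    show "\<forall>(d, a)\<in>S \<union> Pair (Suc L) ` T. d \<le> Suc L"
      using S(4) by (auto simp: le_SucI)
  next
    fix y :: real assume y: "0 \<le> y" "y < 1"
    define n where "n = nat \<lfloor>real b ^ Suc L * y\<rfloor>"
    \<comment> \<open>The cell of \<open>y\<close> at level \<open>L\<close> is the parent of its
      cell at level \<open>Suc L\<close>, so membership in the core can be tested one level
      higher.\<close>
    have "n div b = nat \<lfloor>real b ^ L * y\<rfloor>"
    proof -
      have "\<lfloor>real b ^ Suc L * y\<rfloor> div int b = \<lfloor>real b ^ Suc L * y / real b\<rfloor>"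
        using floor_divide_real_eq_div[of "int b" "real b ^ Suc L * y"] by simp
      also have "real b ^ Suc L * y / real b = real b ^ L * y" using b by simp
      finally show ?thesis unfolding n_def using y
        by (metis nat_div_distrib' nat_int of_nat_0_le_iff)
    qed
    moreover have "n div b \<in> {u'..<v'} \<longleftrightarrow> n \<in> {u' * b..<v' * b}"
      using b by (simp add: less_eq_div_iff_mult_less_eq div_less_iff_less_mult)
    moreover have "(of_bool (n \<in> {u..<v}) :: real) = of_bool (n \<in> {u' * b..<v' * b}) + of_bool (n \<in> T)"
      using subsetD[OF sub, of n] unfolding T_def by (auto simp del: atLeastLessThan_iff)
    moreover have "(\<Sum>a\<in>T. of_bool (n = a) :: real) = of_bool (n \<in> T)"
      using T by (simp add: of_bool_def)
    ultimately show "(of_bool (nat \<lfloor>real b ^ Suc L * y\<rfloor> \<in> {u..<v}) :: real) =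
        (\<Sum>(d, a)\<in>S \<union> Pair (Suc L) ` T. of_bool (nat \<lfloor>real b ^ d * y\<rfloor> = a))"
      unfolding sum_eq prod.case n_def[symmetric] using S(5)[rule_format, OF y] by presburger
  next
    have "card {u..<v} = card {u' * b..<v' * b} + card T"
      using card_Diff_subset[OF finite_atLeastLessThan sub] card_mono[OF finite_atLeastLessThan sub]
      unfolding T_def by linarith
    also have "card {u' * b..<v' * b} = card {u'..<v'} * b" by (simp add: diff_mult_distrib)
    finally have "real (card {u..<v}) / real b ^ Suc L
        = real (card {u'..<v'}) / real b ^ L + card T / real b ^ Suc L"
      using b by (simp add: field_simps)
    then show "real (card {u..<v}) / real b ^ Suc L = (\<Sum>(d, a)\<in>S \<union> Pair (Suc L) ` T. 1 / real b ^ d)"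
      unfolding sum_eq S(6) by simp
  qed
qed

text \<open>Decomposing each side into elementary intervals splits the box into products of such
  intervals. Each product has error at most \<open>R\<close>, and their number is the product of the
  numbers of pieces per side.\<close>

lemma grid_box_error:
  fixes b :: "'s::finite \<Rightarrow> nat" and x :: "nat \<Rightarrow> real ^ 's"
  assumes x: "elementary_count_bound b R x" "range x \<subseteq> unit_cube"
    and b: "\<And>j. b j > 0" and v: "\<And>j. v j \<le> b j ^ L"
  shows "\<bar>real (card {n. n < N \<and> (\<forall>j. nat \<lfloor>real (b j) ^ L * x n $ j\<rfloor> \<in> {u j..<v j})})
     - real N * (\<Prod>j\<in>UNIV. real (card {u j..<v j}) / real (b j) ^ L)\<bar>
     \<le> R * (\<Prod>j\<in>UNIV. real (2 * b j * L + 1))"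
proof -
  have x01: "0 \<le> x n $ j" "x n $ j < 1" for n j
    using x(2) by (auto simp: unit_cube_def half_open_box_def)
  have "\<exists>S. finite S \<and> card S \<le> 2 * b j * L + 1 \<and> (\<forall>(d, a)\<in>S. a < b j ^ d) \<and>
     (\<forall>y::real. 0 \<le> y \<longrightarrow> y < 1 \<longrightarrow>
        (of_bool (nat \<lfloor>real (b j) ^ L * y\<rfloor> \<in> {u j..<v j}) :: real) =
          (\<Sum>(d, a)\<in>S. of_bool (nat \<lfloor>real (b j) ^ d * y\<rfloor> = a))) \<and>
     real (card {u j..<v j}) / real (b j) ^ L = (\<Sum>(d, a)\<in>S. 1 / real (b j) ^ d)" for j
    using interval_elementary_decomposition[OF b v, of j "u j"] by blast
  then obtain S where S: "\<And>j. finite (S j)" "\<And>j. card (S j) \<le> 2 * b j * L + 1"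
      "\<And>j. \<forall>(d, a)\<in>S j. a < b j ^ d"
      "\<And>j y. 0 \<le> y \<longrightarrow> y < 1 \<longrightarrow> (of_bool (nat \<lfloor>real (b j) ^ L * y\<rfloor> \<in> {u j..<v j}) :: real) =
          (\<Sum>(d, a)\<in>S j. of_bool (nat \<lfloor>real (b j) ^ d * y\<rfloor> = a))"
      "\<And>j. real (card {u j..<v j}) / real (b j) ^ L = (\<Sum>(d, a)\<in>S j. 1 / real (b j) ^ d)"
    by metis
  define G where "G = PiE UNIV S"
  define cnt where "cnt g = card {n. n < N \<and>
      (\<forall>j. \<lfloor>real (b j) ^ fst (g j) * x n $ j\<rfloor> = int (snd (g j)))}" for g :: "'s \<Rightarrow> nat \<times> nat"
  have finG: "finite G" unfolding G_def by (rule finite_PiE) (auto simp: S(1))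
  have "real (card {n. n < N \<and> (\<forall>j. nat \<lfloor>real (b j) ^ L * x n $ j\<rfloor> \<in> {u j..<v j})})
      = (\<Sum>n<N. \<Prod>j\<in>UNIV. of_bool (nat \<lfloor>real (b j) ^ L * x n $ j\<rfloor> \<in> {u j..<v j}))"
    unfolding card_eq_sum_of_bool by (simp add: prod_of_bool)
  also have "\<dots> = (\<Sum>n<N. \<Prod>j\<in>UNIV. \<Sum>z\<in>S j. of_bool (nat \<lfloor>real (b j) ^ fst z * x n $ j\<rfloor> = snd z))"
    using S(4) x01 by (simp add: case_prod_beta)
  \<comment> \<open>Distributivity: a choice function \<open>g\<close> picks one piece per
    coordinate, that is, one elementary interval of the decomposition.\<close>
  also have "\<dots> = (\<Sum>n<N. \<Sum>g\<in>G. \<Prod>j\<in>UNIV. of_bool (nat \<lfloor>real (b j) ^ fst (g j) * x n $ j\<rfloor> = snd (g j)))"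
    unfolding G_def by (subst prod_sum_PiE) (auto simp: S(1))
  also have "\<dots> = (\<Sum>n<N. \<Sum>g\<in>G. of_bool (\<forall>j. \<lfloor>real (b j) ^ fst (g j) * x n $ j\<rfloor> = int (snd (g j))))"
    using x01 by (simp add: prod_of_bool nat_eq_iff2 nat_eq_iff)
  also have "\<dots> = (\<Sum>g\<in>G. real (cnt g))"
    unfolding cnt_def card_eq_sum_of_bool by (rule sum.swap)
  finally have c: "real (card {n. n < N \<and> (\<forall>j. nat \<lfloor>real (b j) ^ L * x n $ j\<rfloor> \<in> {u j..<v j})})
      = (\<Sum>g\<in>G. real (cnt g))" .
  have "(\<Prod>j\<in>UNIV. real (card {u j..<v j}) / real (b j) ^ L)
      = (\<Sum>g\<in>G. \<Prod>j\<in>UNIV. 1 / real (b j) ^ fst (g j))"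
    unfolding S(5) case_prod_beta G_def by (subst prod_sum_PiE) (auto simp: S(1))
  then have vol: "real N * (\<Prod>j\<in>UNIV. real (card {u j..<v j}) / real (b j) ^ L)
      = (\<Sum>g\<in>G. real N / (\<Prod>j\<in>UNIV. real (b j) ^ fst (g j)))"
    by (simp add: sum_distrib_left prod_dividef)
  \<comment> \<open>The case \<open>N = 0\<close> of the bound already forces this.\<close>
  have R0: "R \<ge> 0"
    using elementary_count_boundD[OF x(1), of "\<lambda>_. 0" "\<lambda>_. 0" 0] by simp
  have "\<bar>(\<Sum>g\<in>G. real (cnt g)) - (\<Sum>g\<in>G. real N / (\<Prod>j\<in>UNIV. real (b j) ^ fst (g j)))\<bar>
      \<le> (\<Sum>g\<in>G. \<bar>real (cnt g) - real N / (\<Prod>j\<in>UNIV. real (b j) ^ fst (g j))\<bar>)"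
    unfolding sum_subtractf[symmetric] by (rule sum_abs)
  also have "\<dots> \<le> (\<Sum>g\<in>G. R)"
  proof (rule sum_mono)
    fix g assume g: "g \<in> G"
    have "snd (g j) < b j ^ fst (g j)" for j
      using g S(3)[of j] unfolding G_def by (auto dest: PiE_mem[of g UNIV S j] simp: case_prod_beta)
    then show "\<bar>real (cnt g) - real N / (\<Prod>j\<in>UNIV. real (b j) ^ fst (g j))\<bar> \<le> R"
      unfolding cnt_def by (rule elementary_count_boundD[OF x(1)])
  qed
  also have "\<dots> = R * (\<Prod>j\<in>UNIV. real (card (S j)))"
    by (simp add: G_def card_PiE)
  also have "\<dots> \<le> R * (\<Prod>j\<in>UNIV. real (2 * b j * L + 1))"
    by (intro mult_left_mono prod_mono conjI of_nat_mono S(2) R0 of_nat_0_le_iff)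
  finally show ?thesis unfolding c vol .
qed

section \<open>Lebesgue measure of half-open boxes and boxes inside the unit cube\<close>

lemma half_open_box_measurable: "half_open_box a b \<in> sets lborel"
proof -
  have "half_open_box a b = (\<Inter>i. {y. a $ i \<le> y $ i} \<inter> {y. y $ i < b $ i})"
    by (auto simp: half_open_box_def)
  moreover have "{y. a $ i \<le> y $ i} \<inter> {y. y $ i < b $ i} \<in> sets borel" for i
    by (intro sets.Int borel_closed borel_open closed_Collect_le open_Collect_less continuous_intros)
  ultimately show ?thesis by (auto intro!: sets.countable_INT')
qed

text \<open>The box lies between the open and the closed box with the same corners, and these have
  equal measure.\<close>

lemma measure_half_open_box:
  assumes "\<And>i. a $ i \<le> b $ i"
  shows "measure lborel (half_open_box a b) = (\<Prod>i\<in>UNIV. b $ i - a $ i)"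
proof -
  have sub: "box a b \<subseteq> half_open_box a b" "half_open_box a b \<subseteq> cbox a b"
    by (auto simp: half_open_box_def mem_box_cart less_imp_le)
  have ab: "\<forall>i\<in>Basis. a \<bullet> i \<le> b \<bullet> i"
    using assms by (auto simp: Basis_vec_def inner_axis)
  have "half_open_box a b \<in> fmeasurable lborel"
    by (rule fmeasurableI2[OF _ sub(2) half_open_box_measurable]) simp
  then have "measure lborel (box a b) \<le> measure lborel (half_open_box a b)"
    "measure lborel (half_open_box a b) \<le> measure lborel (cbox a b)"
    using sub half_open_box_measurable[of a b]
    by (auto intro!: measure_mono_fmeasurable)
  moreover have "measure lborel (box a b) = measure lborel (cbox a b)"
    using ab by (simp add: measure_lborel_box_eq measure_lborel_cbox_eq)
  moreover have "measure lborel (cbox a b) = (\<Prod>i\<in>UNIV. b $ i - a $ i)"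
    using assms by (intro content_cbox_cart) (auto simp: interval_eq_empty_cart not_less)
  ultimately show ?thesis by linarith
qed

lemma half_open_box_nonempty_imp_less: "half_open_box a b \<noteq> {} \<Longrightarrow> a $ i < b $ i"
  unfolding half_open_box_def using le_less_trans by blast

text \<open>The corner \<open>a\<close> belongs to a nonempty box. If \<open>b $ i\<close> exceeded
  1, replacing coordinate \<open>i\<close> of \<open>a\<close> by 1 would give a point of the box
  outside the cube.\<close>

lemma half_open_box_subset_unit_cubeD:
  assumes sub: "half_open_box a b \<subseteq> unit_cube" and ne: "half_open_box a b \<noteq> {}"
  shows "0 \<le> a $ i" "b $ i \<le> 1"
proof -
  have less: "a $ j < b $ j" for j using half_open_box_nonempty_imp_less[OF ne] .
  then have "a \<in> half_open_box a b" by (simp add: half_open_box_def)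
  then have a: "a \<in> unit_cube" using sub by blast
  then show "0 \<le> a $ i" by (simp add: unit_cube_def half_open_box_def)
  show "b $ i \<le> 1"
  proof (rule ccontr)
    assume b: "\<not> b $ i \<le> 1"
    have "(\<chi> j. if j = i then 1 else a $ j) \<in> half_open_box a b"
      using a b less by (auto simp: half_open_box_def unit_cube_def less_imp_le)
    then have "(\<chi> j. if j = i then 1 else a $ j) \<in> unit_cube" using sub by blast
    then have "(\<chi> j. if j = i then 1 else a $ j) $ i < (1 :: real ^ 'a) $ i"
      unfolding unit_cube_def half_open_box_def by blast
    then show False by simp
  qed
qed

text \<open>The local discrepancy before division by \<open>N\<close>: in this form it is a partial
  sum over the points, ready for summation by parts.\<close>

definition box_error :: "(nat \<Rightarrow> real ^ 's) \<Rightarrow> (real ^ 's) set \<Rightarrow> nat \<Rightarrow> real" where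
  "box_error x B N = real (card {n. n < N \<and> x n \<in> B}) - real N * measure lborel B"

text \<open>Rounding the corners outwards and inwards to the grid of level \<open>L\<close> gives
  two grid boxes whose counts enclose the true count. The mesh is at most \<open>1 / N\<close>, so
  rounding changes \<open>N\<close> times the volume by at most 2 per coordinate.\<close>

lemma box_error_bound_level:
  fixes b :: "'s::finite \<Rightarrow> nat" and x :: "nat \<Rightarrow> real ^ 's"
  assumes x: "elementary_count_bound b R x" "range x \<subseteq> unit_cube"
    and b: "\<And>j. b j > 0" and sub: "half_open_box \<alpha> \<beta> \<subseteq> unit_cube"
    and N: "\<And>j. N \<le> b j ^ L"
  shows "\<bar>box_error x (half_open_box \<alpha> \<beta>) N\<bar>
     \<le> R * (\<Prod>j\<in>UNIV. real (2 * b j * L + 1)) + 2 * CARD('s)"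
proof (cases "half_open_box \<alpha> \<beta> = {}")
  case True
  have "R \<ge> 0"
    using elementary_count_boundD[OF x(1), of "\<lambda>_. 0" "\<lambda>_. 0" 0] by simp
  then show ?thesis using True by (simp add: box_error_def prod_nonneg)
next
  case False
  define e where "e j = real (b j) ^ L" for j
  have e0: "e j > 0" for j using b by (simp add: e_def)
  have less: "\<alpha> $ j < \<beta> $ j" for j using half_open_box_nonempty_imp_less[OF False] .
  have a0: "0 \<le> \<alpha> $ j" and b1: "\<beta> $ j \<le> 1" for j
    using half_open_box_subset_unit_cubeD[OF sub False] by auto
  have x01: "0 \<le> x n $ j" "x n $ j < 1" for n j
    using x(2) by (auto simp: unit_cube_def half_open_box_def)
  define V where "V = (\<Prod>j\<in>UNIV. \<beta> $ j - \<alpha> $ j)"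
  have V: "measure lborel (half_open_box \<alpha> \<beta>) = V"
    unfolding V_def using less by (intro measure_half_open_box) (simp add: less_imp_le)
  define E where "E = R * (\<Prod>j\<in>UNIV. real (2 * b j * L + 1))"
  define cnt where "cnt u v = real (card {n. n < N \<and>
      (\<forall>j. nat \<lfloor>e j * x n $ j\<rfloor> \<in> {u j..<v j})})" for u v :: "'s \<Rightarrow> nat"
  define vol where "vol u v = (\<Prod>j\<in>UNIV. real (card {u j..<v j}) / e j)" for u v :: "'s \<Rightarrow> nat"
  have grid: "\<bar>cnt u v - N * vol u v\<bar> \<le> E" if "\<And>j. v j \<le> b j ^ L" for u v
    unfolding cnt_def vol_def E_def e_def by (rule grid_box_error[OF x b that])
  have vol_diff: "N * \<bar>vol u v - V\<bar> \<le> 2 * CARD('s)"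
    if uv: "\<And>j. v j \<le> b j ^ L" "\<And>j. \<bar>card {u j..<v j} - (\<beta> $ j - \<alpha> $ j) * e j\<bar> \<le> 2" for u v
  proof -
    \<comment> \<open>Two products with factors of absolute value at most 1 differ by at most the
      sum of the differences of the factors.\<close>
    have "\<bar>vol u v - V\<bar> \<le> (\<Sum>j\<in>UNIV. \<bar>real (card {u j..<v j}) / e j - (\<beta> $ j - \<alpha> $ j)\<bar>)"
      unfolding vol_def V_def real_norm_def[symmetric]
    proof (rule norm_prod_diff)
      fix j
      have "real (card {u j..<v j}) \<le> e j"
        unfolding e_def using uv(1)[of j] by (simp add: of_nat_le_iff[symmetric] del: of_nat_le_iff)
      then show "norm (real (card {u j..<v j}) / e j) \<le> 1" using e0[of j] by simp
      show "norm (\<beta> $ j - \<alpha> $ j) \<le> 1" using less[of j] a0[of j] b1[of j] by simp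
    qed
    then have "N * \<bar>vol u v - V\<bar>
        \<le> N * (\<Sum>j\<in>UNIV. \<bar>real (card {u j..<v j}) / e j - (\<beta> $ j - \<alpha> $ j)\<bar>)"
      by (rule mult_left_mono) simp
    also have "\<dots> \<le> (\<Sum>j\<in>(UNIV::'s set). 2)"
      unfolding sum_distrib_left
    proof (rule sum_mono)
      fix j
      have "real (card {u j..<v j}) / e j - (\<beta> $ j - \<alpha> $ j)
          = (card {u j..<v j} - (\<beta> $ j - \<alpha> $ j) * e j) / e j"
        using e0[of j] by (simp add: field_simps)
      then have "N * \<bar>real (card {u j..<v j}) / e j - (\<beta> $ j - \<alpha> $ j)\<bar>
          = (N / e j) * \<bar>card {u j..<v j} - (\<beta> $ j - \<alpha> $ j) * e j\<bar>"
        using e0[of j] by (simp add: abs_divide)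
      \<comment> \<open>The hypothesis \<open>N \<le> b j ^ L\<close> enters here: \<open>N\<close>
        times the width of one cell is at most 1.\<close>
      also have "\<dots> \<le> 1 * 2"
      proof (rule mult_mono)
        have "real N \<le> e j" unfolding e_def using N[of j] by (metis of_nat_le_iff of_nat_power)
        then show "N / e j \<le> 1" using e0[of j] by simp
      qed (use uv(2) in auto)
      finally show "N * \<bar>real (card {u j..<v j}) / e j - (\<beta> $ j - \<alpha> $ j)\<bar> \<le> 2" by simp
    qed
    finally show ?thesis by simp
  qed
  define M where "M = real (card {n. n < N \<and> x n \<in> half_open_box \<alpha> \<beta>})"
  \<comment> \<open>The outer grid box has corners \<open>ul\<close> and \<open>vu\<close>, the
    inner one \<open>uu\<close> and \<open>vl\<close>.\<close>
  define ul where "ul j = nat \<lfloor>e j * \<alpha> $ j\<rfloor>" for j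
  define uu where "uu j = nat \<lceil>e j * \<alpha> $ j\<rceil>" for j
  define vl where "vl j = nat \<lfloor>e j * \<beta> $ j\<rfloor>" for j
  define vu where "vu j = nat \<lceil>e j * \<beta> $ j\<rceil>" for j
  have ea: "0 \<le> e j * \<alpha> $ j" and eab: "e j * \<alpha> $ j < e j * \<beta> $ j" and eb: "e j * \<beta> $ j \<le> e j" for j
    using a0[of j] b1[of j] less[of j] e0[of j] by simp_all
  have e_int: "e j = real_of_int (int (b j ^ L))" for j by (simp add: e_def)
  have vu: "vu j \<le> b j ^ L" for j
    using eb[of j] unfolding vu_def by (simp add: e_int nat_le_iff ceiling_le_iff)
  have vlu: "vl j \<le> vu j" for j
    unfolding vl_def vu_def by (intro nat_mono) linarith
  have vl: "vl j \<le> b j ^ L" for j using vu[of j] vlu[of j] by simp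
  have r: "real (ul j) = of_int \<lfloor>e j * \<alpha> $ j\<rfloor>" "real (uu j) = of_int \<lceil>e j * \<alpha> $ j\<rceil>"
     "real (vl j) = of_int \<lfloor>e j * \<beta> $ j\<rfloor>" "real (vu j) = of_int \<lceil>e j * \<beta> $ j\<rceil>" for j
    using ea[of j] eab[of j] by (simp_all add: ul_def uu_def vl_def vu_def)
  have "M \<le> cnt ul vu"
    unfolding M_def cnt_def
  proof (intro of_nat_mono card_mono subsetI)
    fix n assume "n \<in> {n. n < N \<and> x n \<in> half_open_box \<alpha> \<beta>}"
    then have n: "n < N" "\<And>j. \<alpha> $ j \<le> x n $ j" "\<And>j. x n $ j < \<beta> $ j"
      by (auto simp: half_open_box_def)
    have "nat \<lfloor>e j * x n $ j\<rfloor> \<in> {ul j..<vu j}" for j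
    proof -
      have "e j * \<alpha> $ j \<le> e j * x n $ j" "e j * x n $ j < e j * \<beta> $ j"
        using n(2)[of j] n(3)[of j] e0[of j] by auto
      then have "\<lfloor>e j * \<alpha> $ j\<rfloor> \<le> \<lfloor>e j * x n $ j\<rfloor>" "\<lfloor>e j * x n $ j\<rfloor> < \<lceil>e j * \<beta> $ j\<rceil>"
        by (auto intro: floor_mono) linarith
      then show ?thesis using ea[of j] eab[of j] unfolding ul_def vu_def
        by (auto simp: nat_less_eq_zless intro!: nat_mono)
    qed
    then show "n \<in> {n. n < N \<and> (\<forall>j. nat \<lfloor>e j * x n $ j\<rfloor> \<in> {ul j..<vu j})}" using n by blast
  qed simp
  moreover have "cnt uu vl \<le> M"
    unfolding M_def cnt_def
  proof (intro of_nat_mono card_mono subsetI)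
    fix n assume n: "n \<in> {n. n < N \<and> (\<forall>j. nat \<lfloor>e j * x n $ j\<rfloor> \<in> {uu j..<vl j})}"
    have "\<alpha> $ j \<le> x n $ j \<and> x n $ j < \<beta> $ j" for j
    proof -
      have "0 \<le> e j * x n $ j" using e0[of j] x01(1)[of n j] by simp
      moreover have "nat \<lfloor>e j * x n $ j\<rfloor> \<in> {uu j..<vl j}" using n by blast
      ultimately have "\<lceil>e j * \<alpha> $ j\<rceil> \<le> \<lfloor>e j * x n $ j\<rfloor>" "\<lfloor>e j * x n $ j\<rfloor> < \<lfloor>e j * \<beta> $ j\<rfloor>"
        using ea[of j] eab[of j] unfolding uu_def vl_def by (auto simp: ceiling_le_iff)
      then have "e j * \<alpha> $ j \<le> e j * x n $ j" "e j * x n $ j < e j * \<beta> $ j" by linarith+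
      then show ?thesis using e0[of j] by auto
    qed
    then show "n \<in> {n. n < N \<and> x n \<in> half_open_box \<alpha> \<beta>}" using n by (auto simp: half_open_box_def)
  qed simp
  moreover have "\<bar>cnt ul vu - N * vol ul vu\<bar> \<le> E" "\<bar>cnt uu vl - N * vol uu vl\<bar> \<le> E"
    using grid[of vu ul] grid[of vl uu] vu vl by auto
  moreover have "N * \<bar>vol ul vu - V\<bar> \<le> 2 * CARD('s)"
  proof (rule vol_diff[OF vu])
    fix j
    have "ul j \<le> vu j" unfolding ul_def vu_def using eab[of j] by (intro nat_mono) linarith
    then show "\<bar>card {ul j..<vu j} - (\<beta> $ j - \<alpha> $ j) * e j\<bar> \<le> 2"
      by (simp add: of_nat_diff r algebra_simps) linarith
  qed
  moreover have "N * \<bar>vol uu vl - V\<bar> \<le> 2 * CARD('s)"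
  proof (rule vol_diff[OF vl])
    fix j
    show "\<bar>card {uu j..<vl j} - (\<beta> $ j - \<alpha> $ j) * e j\<bar> \<le> 2"
    proof (cases "uu j \<le> vl j")
      case True
      then show ?thesis by (simp add: of_nat_diff r algebra_simps) linarith
    next
      \<comment> \<open>A thin box may contain no full cell in direction \<open>j\<close>. The cell
        count is then 0, and the scaled side length is itself less than 2.\<close>
      case False
      then have "real (vl j) < real (uu j)" by simp
      then show ?thesis using False eab[of j] by (simp add: r algebra_simps) linarith
    qed
  qed
  ultimately have "M - N * V \<le> E + 2 * CARD('s)" "N * V - M \<le> E + 2 * CARD('s)"
    using mult_left_mono[OF abs_ge_self[of "vol ul vu - V"], of "real N"]
      mult_left_mono[OF abs_ge_minus_self[of "vol uu vl - V"], of "real N"]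
    by (auto simp: abs_le_iff right_diff_distrib)
  then show ?thesis unfolding box_error_def V M_def[symmetric] E_def[symmetric]
    by (simp add: abs_le_iff)
qed

text \<open>A level \<open>L\<close> of order \<open>log N\<close> makes the grid fine enough in
  every base. The bound is uniform over all \<open>k \<le> N\<close> and all boxes, because
  summation by parts needs one bound for all partial sums.\<close>

lemma box_error_bound:
  fixes b :: "'s::finite \<Rightarrow> nat" and x :: "nat \<Rightarrow> real ^ 's"
  assumes x: "elementary_count_bound b R x" "range x \<subseteq> unit_cube" and b: "\<And>j. b j \<ge> 2"
  shows "\<exists>C\<ge>0. \<forall>N\<ge>2. \<forall>k\<le>N. \<forall>\<alpha> \<beta>. half_open_box \<alpha> \<beta> \<subseteq> unit_cube \<longrightarrow>
    \<bar>box_error x (half_open_box \<alpha> \<beta>) k\<bar> \<le> C * ln (real N) ^ CARD('s)"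
proof -
  \<comment> \<open>Chosen so that \<open>L \<le> log 2 N + 1 \<le> 2 * log 2 N = c * ln N\<close>
    for \<open>N \<ge> 2\<close>.\<close>
  define c where "c = 2 / ln (2::real)"
  have c: "c > 0" by (simp add: c_def)
  have R0: "R \<ge> 0"
    using elementary_count_boundD[OF x(1), of "\<lambda>_. 0" "\<lambda>_. 0" 0] by simp
  \<comment> \<open>The factor 3 comes from \<open>2 * b j * L + 1 \<le> 3 * b j * L\<close>. The
    additive rounding term is absorbed because \<open>1 \<le> c * ln N\<close>.\<close>
  define C where "C = R * (\<Prod>j\<in>UNIV. real (3 * b j) * c) + 2 * CARD('s) * c ^ CARD('s)"
  have C0: "C \<ge> 0" unfolding C_def using R0 c by (intro add_nonneg_nonneg mult_nonneg_nonneg prod_nonneg) auto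
  show ?thesis
  proof (intro exI[of _ C] conjI allI impI C0)
    fix N k :: nat and \<alpha> \<beta> :: "real ^ 's"
    assume N: "2 \<le> N" and k: "k \<le> N" and sub: "half_open_box \<alpha> \<beta> \<subseteq> unit_cube"
    define L where "L = nat \<lceil>log 2 (real N)\<rceil>"
    have log1: "log 2 (real N) \<ge> 1" using N by simp
    then have L: "log 2 (real N) \<le> real L" "real L \<le> log 2 (real N) + 1" "L \<ge> 1"
      unfolding L_def by linarith+
    have "real N \<le> 2 powr real L" using L(1) N by (simp add: log_le_iff)
    then have "real N \<le> real (2 ^ L)" by (simp add: powr_realpow)
    then have "N \<le> 2 ^ L" using of_nat_le_iff by blast
    also have "(2::nat) ^ L \<le> b j ^ L" for j using b by (intro power_mono) auto
    finally have kL: "k \<le> b j ^ L" for j using k by (meson le_trans)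
    have Lc: "real L \<le> c * ln (real N)"
    proof -
      have "c * ln (real N) = 2 * log 2 (real N)" by (simp add: c_def log_def)
      then show ?thesis using L(2) log1 by linarith
    qed
    have t1: "1 \<le> c * ln (real N)" using L(3) Lc by linarith
    have "\<bar>box_error x (half_open_box \<alpha> \<beta>) k\<bar> \<le> R * (\<Prod>j\<in>UNIV. real (2 * b j * L + 1)) + 2 * CARD('s)"
      by (rule box_error_bound_level[OF x _ sub kL]) (rule less_le_trans[OF _ b], simp)
    also have "\<dots> \<le> R * (\<Prod>j\<in>UNIV. real (3 * b j) * c * ln (real N)) + 2 * CARD('s) * (c * ln (real N)) ^ CARD('s)"
    proof (intro add_mono mult_left_mono R0 prod_mono conjI)
      fix j
      have "1 * 1 \<le> b j * L" using b[of j] L(3) by (intro mult_mono) auto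
      then have "real (2 * b j * L + 1) \<le> real (3 * b j * L)" unfolding of_nat_le_iff by simp
      also have "\<dots> = real (3 * b j) * real L" by simp
      also have "\<dots> \<le> real (3 * b j) * (c * ln (real N))" using Lc by (intro mult_left_mono) auto
      finally show "real (2 * b j * L + 1) \<le> real (3 * b j) * c * ln (real N)" by (simp add: mult.assoc)
      have "1 \<le> (c * ln (real N)) ^ CARD('s)" using t1 by (rule one_le_power)
      then show "real (2 * CARD('s)) \<le> real (2 * CARD('s)) * (c * ln (real N)) ^ CARD('s)"
        using mult_left_mono[of 1 "(c * ln (real N)) ^ CARD('s)" "real (2 * CARD('s))"] by simp
    qed auto
    also have "\<dots> = C * ln (real N) ^ CARD('s)"
      by (simp add: C_def prod.distrib power_mult_distrib algebra_simps)
    finally show "\<bar>box_error x (half_open_box \<alpha> \<beta>) k\<bar> \<le> C * ln (real N) ^ CARD('s)" .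
  qed
qed

subsection \<open>Halton sequences\<close>

lemma radical_inverse_conv_digit_value: "radical_inverse b n = digit_value b (digit b n)"
  by (simp add: radical_inverse_def digit_value_def)

text \<open>Lying in an elementary interval prescribes the residue of \<open>n\<close> modulo each
  \<open>b j ^ d j\<close>. By the Chinese remainder theorem every block of \<open>Q\<close>
  consecutive indices contains exactly one solution, hence the error 1.\<close>

lemma elementary_count_bound_halton:
  fixes b :: "'s::finite \<Rightarrow> nat"
  assumes b: "\<And>i. b i \<ge> 2" and cop: "\<And>i j. i \<noteq> j \<Longrightarrow> coprime (b i) (b j)"
  shows "elementary_count_bound b 1 (halton b)"
  unfolding elementary_count_bound_def
proof (intro allI impI)
  fix d a :: "'s \<Rightarrow> nat" and N
  assume a: "\<forall>j. a j < b j ^ d j"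
  have bp: "b j > 0" for j using b[of j] by simp
  have "\<exists>r. \<forall>n. \<lfloor>real (b j) ^ d j * halton b n $ j\<rfloor> = int (a j) \<longleftrightarrow> [n = r] (mod b j ^ d j)" for j
  proof -
    obtain e where e: "\<And>i. i < d j \<Longrightarrow> e i < b j"
      "\<And>g. \<lbrakk>\<forall>i. g i < b j; \<forall>\<^sub>F i in sequentially. g i = 0\<rbrakk> \<Longrightarrow>
        \<lfloor>real (b j) ^ d j * digit_value (b j) g\<rfloor> = int (a j) \<longleftrightarrow> (\<forall>i<d j. g i = e i)"
      using floor_digit_value_eq_iff[OF a[rule_format, of j] bp[of j]] by (elim exE conjE) blast
    obtain r where r: "r < b j ^ d j"
      "\<And>n. (\<forall>i<d j. digit (b j) n i = e i) \<longleftrightarrow> n mod b j ^ d j = r"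
      using mod_power_eq_iff_digits[of "d j" e, OF _ bp[of j]] e(1) by (meson that)
    have "\<lfloor>real (b j) ^ d j * halton b n $ j\<rfloor> = int (a j) \<longleftrightarrow> [n = r] (mod b j ^ d j)" for n
      using e(2)[of "digit (b j) n"] r digit_less[OF bp] digit_eventually_0[OF b]
      by (simp add: halton_def radical_inverse_conv_digit_value cong_def)
    then show ?thesis by blast
  qed
  then obtain r where r: "\<And>n j. \<lfloor>real (b j) ^ d j * halton b n $ j\<rfloor> = int (a j) \<longleftrightarrow>
      [n = r j] (mod b j ^ d j)"
    by metis
  define Q where "Q = (\<Prod>j\<in>UNIV. b j ^ d j)"
  have Qp: "Q > 0" unfolding Q_def using bp by (intro prod_pos) auto
  have "card {n. n < Q \<and> (\<forall>j. \<lfloor>real (b j) ^ d j * halton b (k * Q + n) $ j\<rfloor> = int (a j))} = 1" for k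
  proof -
    have "[k * Q = 0] (mod b j ^ d j)" for j
      using dvd_prodI[of UNIV j "\<lambda>j. b j ^ d j"] by (simp add: Q_def cong_0_iff dvd_mult)
    then have "[k * Q + n = n] (mod b j ^ d j)" for n j
      using cong_add_rcancel_nat[of "k * Q" n 0 "b j ^ d j"] by simp
    then have "[k * Q + n = r j] (mod b j ^ d j) \<longleftrightarrow> [n = r j] (mod b j ^ d j)" for n j
      by (meson cong_sym cong_trans)
    moreover have "\<exists>!n. n < Q \<and> (\<forall>j\<in>UNIV. [n = r j] (mod b j ^ d j))"
      unfolding Q_def
      by (rule chinese_remainder_unique_nat) (use bp cop in auto)
    ultimately have "\<exists>!n. n < Q \<and> (\<forall>j. [k * Q + n = r j] (mod b j ^ d j))" by simp
    then show ?thesis unfolding r by (auto simp: card_1_singleton_iff)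
  qed
  from block_count_error[OF Qp this, of N]
  show "\<bar>real (card {n. n < N \<and> (\<forall>j. \<lfloor>real (b j) ^ d j * halton b n $ j\<rfloor> = int (a j))})
           - real N / (\<Prod>j\<in>UNIV. real (b j) ^ d j)\<bar> \<le> 1"
    by (simp add: Q_def)
qed

lemma range_halton_subset:
  assumes "\<And>i. b i \<ge> 2"
  shows "range (halton b) \<subseteq> unit_cube"
proof -
  have "b i > 0" for i using assms[of i] by simp
  then show ?thesis
    using digit_value_bounds[OF digit_less digit_eventually_0] assms
    by (auto simp: unit_cube_def half_open_box_def halton_def radical_inverse_conv_digit_value)
qed

subsection \<open>Digital sequences\<close>

lemma digit_block_low: "0 < p \<Longrightarrow> w < m \<Longrightarrow> digit p (k * p ^ m + l) w = digit p l w"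
proof -
  assume p: "0 < p" and w: "w < m"
  have "k * p ^ m = (k * p ^ (m - Suc w)) * p * p ^ w"
    using power_add[of p "m - Suc w" "Suc w"] w by simp
  then have "(k * p ^ m + l) div p ^ w = k * p ^ (m - Suc w) * p + l div p ^ w"
    using div_mult_self3[of "p ^ w" "k * p ^ (m - Suc w) * p" l] p by (simp only:) simp
  then show ?thesis by (simp add: digit_def)
qed

lemma digit_block_high: "0 < p \<Longrightarrow> l < p ^ m \<Longrightarrow> digit p (k * p ^ m + l) (m + w) = digit p k w"
  by (simp add: digit_def power_add div_mult2_eq)

text \<open>As \<open>l\<close> runs through \<open>{..<p ^ m}\<close>, its digit vector runs once
  through all vectors of length \<open>m\<close>, so this is the distributive law. The induction
  splits off the top digit.\<close>

lemma sum_prod_digits: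
  fixes h :: "nat \<Rightarrow> nat \<Rightarrow> 'a :: comm_semiring_1"
  assumes p: "p > 0"
  shows "(\<Sum>l<p ^ m. \<Prod>w<m. h w (digit p l w)) = (\<Prod>w<m. \<Sum>x<p. h w x)"
proof (induction m)
  case 0
  then show ?case by simp
next
  case (Suc m)
  have "(\<Sum>l<p ^ Suc m. \<Prod>w<Suc m. h w (digit p l w))
      = (\<Sum>x<p. \<Sum>l=x * p ^ m..<x * p ^ m + p ^ m. \<Prod>w<Suc m. h w (digit p l w))"
    by (simp add: sum.nat_group)
  also have "\<dots> = (\<Sum>x<p. \<Sum>l<p ^ m. \<Prod>w<Suc m. h w (digit p (x * p ^ m + l) w))"
  proof (rule sum.cong[OF refl])
    fix x
    show "(\<Sum>l=x * p ^ m..<x * p ^ m + p ^ m. \<Prod>w<Suc m. h w (digit p l w))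
      = (\<Sum>l<p ^ m. \<Prod>w<Suc m. h w (digit p (x * p ^ m + l) w))"
      using sum.shift_bounds_nat_ivl[of "\<lambda>l. \<Prod>w<Suc m. h w (digit p l w)" 0 "x * p ^ m" "p ^ m"]
      by (simp add: lessThan_atLeast0 add.commute)
  qed
  also have "\<dots> = (\<Sum>x<p. \<Sum>l<p ^ m. (\<Prod>w<m. h w (digit p l w)) * h m x)"
  proof (intro sum.cong refl)
    fix x l assume x: "x \<in> {..<p}" and l: "l \<in> {..<p ^ m}"
    have "digit p (x * p ^ m + l) m = x"
      using digit_block_high[OF p, of l m x 0] x l by (simp add: digit_def)
    then show "(\<Prod>w<Suc m. h w (digit p (x * p ^ m + l) w)) = (\<Prod>w<m. h w (digit p l w)) * h m x"
      using p by (simp add: digit_block_low)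
  qed
  also have "\<dots> = (\<Prod>w<Suc m. \<Sum>x<p. h w x)"
    by (simp add: Suc.IH[symmetric] sum_distrib_left sum_distrib_right)
  finally show ?case .
qed

section \<open>Additive characters and linear systems modulo \<open>p\<close>\<close>

definition unit_character :: "nat \<Rightarrow> nat \<Rightarrow> complex" where
  "unit_character p a = exp (2 * of_real pi * \<i> * of_nat a / of_nat p)"

lemma unit_character_0: "unit_character p 0 = 1"
  by (simp add: unit_character_def)

lemma unit_character_add: "unit_character p (a + b) = unit_character p a * unit_character p b"
  by (simp add: unit_character_def exp_add[symmetric] add_divide_distrib ring_distribs)

lemma unit_character_sum: "unit_character p (sum f A) = (\<Prod>a\<in>A. unit_character p (f a))"
  by (induction A rule: infinite_finite_induct) (simp_all add: unit_character_0 unit_character_add)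

text \<open>Orthogonality of characters: a geometric sum over the powers of a \<open>p\<close>-th
  root of unity, which is 1 exactly when \<open>p\<close> divides \<open>n\<close>.\<close>

lemma sum_unit_character:
  assumes p: "p > 0"
  shows "(\<Sum>c<p. unit_character p (c * n)) = of_nat p * of_bool (p dvd n)"
proof -
  define z where "z = unit_character p n"
  have pow: "unit_character p (c * n) = z ^ c" for c
    unfolding z_def by (induction c) (simp_all add: unit_character_0 unit_character_add)
  have z1: "z = 1 \<longleftrightarrow> p dvd n"
    unfolding z_def unit_character_def by (rule complex_root_unity_eq_1) (use p in simp)
  have "z ^ p = 1"
    using complex_root_unity_eq_1[of p "p * n"] p unfolding pow[symmetric] by (simp add: unit_character_def)
  then show ?thesis
    unfolding pow z1[symmetric] by (cases "z = 1") (simp_all add: geometric_sum)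
qed

text \<open>
  After expanding the indicator of each congruence into additive characters, only the trivial
  linear combination of the rows contributes, by independence.
\<close>

lemma linear_system_count:
  fixes M :: "'i \<Rightarrow> nat \<Rightarrow> nat"
  assumes p: "p > 0" and I: "finite I"
    and indep: "\<And>c. \<lbrakk>c \<in> I \<rightarrow>\<^sub>E {..<p}; \<forall>w<m. p dvd (\<Sum>i\<in>I. c i * M i w)\<rbrakk> \<Longrightarrow> \<forall>i\<in>I. c i = 0"
  shows "card {l. l < p ^ m \<and> (\<forall>i\<in>I. p dvd (\<Sum>w<m. M i w * digit p l w) + k i)} * p ^ card I = p ^ m"
proof -
  define Y where "Y i l = (\<Sum>w<m. M i w * digit p l w) + k i" for i l
  define H where "H c w = (\<Sum>i\<in>I. c i * M i w)" for c w
  define K where "K c = (\<Sum>i\<in>I. c i * k i)" for c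
  \<comment> \<open>The trivial coefficient vector; the restriction makes it extensional, hence an
    element of \<open>?G\<close>.\<close>
  define z where "z = restrict (\<lambda>_. 0::nat) I"
  let ?\<omega> = "unit_character p"
  let ?G = "I \<rightarrow>\<^sub>E {..<p}"
  have G: "finite ?G" using I by (simp add: finite_PiE)
  have pob: "(\<Prod>i\<in>A. of_nat p * of_bool (P i) :: complex) = of_nat p ^ card A * of_bool (\<forall>i\<in>A. P i)"
    if "finite A" for A :: "'b set" and P
    using that by (induction A rule: finite_induct) auto
  have "of_nat (card {l. l < p ^ m \<and> (\<forall>i\<in>I. p dvd Y i l)} * p ^ card I)
      = (\<Sum>l<p ^ m. of_nat p ^ card I * of_bool (\<forall>i\<in>I. p dvd Y i l) :: complex)"
  proof -
    have "(\<Sum>l<p ^ m. of_bool (\<forall>i\<in>I. p dvd Y i l) :: complex)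
        = (\<Sum>l | l < p ^ m \<and> (\<forall>i\<in>I. p dvd Y i l). 1)"
      by (rule sum.mono_neutral_cong_right[OF finite_lessThan]) auto
    then show ?thesis unfolding sum_distrib_left[symmetric] by simp
  qed
  \<comment> \<open>The factor \<open>p ^ card I\<close> supplies one \<open>p\<close> for each
    indicator, as orthogonality demands.\<close>
  also have "\<dots> = (\<Sum>l<p ^ m. \<Prod>i\<in>I. \<Sum>c<p. ?\<omega> (c * Y i l))"
    unfolding sum_unit_character[OF p] pob[OF I] ..
  also have "\<dots> = (\<Sum>l<p ^ m. \<Sum>c\<in>?G. \<Prod>i\<in>I. ?\<omega> (c i * Y i l))"
    using I by (simp add: prod_sum_PiE)
  also have "\<dots> = (\<Sum>c\<in>?G. \<Sum>l<p ^ m. \<Prod>i\<in>I. ?\<omega> (c i * Y i l))"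
    by (rule sum.swap)
  also have "\<dots> = (\<Sum>c\<in>?G. \<Sum>l<p ^ m. ?\<omega> (K c) * (\<Prod>w<m. ?\<omega> (digit p l w * H c w)))"
  proof (intro sum.cong refl)
    fix c l
    have "(\<Sum>i\<in>I. c i * Y i l) = K c + (\<Sum>i\<in>I. \<Sum>w<m. digit p l w * (c i * M i w))"
    proof -
      have "c i * Y i l = c i * k i + (\<Sum>w<m. digit p l w * (c i * M i w))" for i
        by (simp add: Y_def distrib_left sum_distrib_left mult_ac)
      then show ?thesis by (simp add: K_def sum.distrib)
    qed
    also have "\<dots> = K c + (\<Sum>w<m. digit p l w * H c w)"
      by (subst sum.swap) (simp add: H_def sum_distrib_left)
    finally show "(\<Prod>i\<in>I. ?\<omega> (c i * Y i l)) = ?\<omega> (K c) * (\<Prod>w<m. ?\<omega> (digit p l w * H c w))"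
      unfolding unit_character_sum[symmetric] unit_character_add[symmetric] by (rule arg_cong)
  qed
  also have "\<dots> = (\<Sum>c\<in>?G. ?\<omega> (K c) * (\<Prod>w<m. of_nat p * of_bool (p dvd H c w)))"
  proof (intro sum.cong refl)
    fix c
    show "(\<Sum>l<p ^ m. ?\<omega> (K c) * (\<Prod>w<m. ?\<omega> (digit p l w * H c w)))
      = ?\<omega> (K c) * (\<Prod>w<m. of_nat p * of_bool (p dvd H c w))"
      using sum_prod_digits[OF p, of "\<lambda>w x. ?\<omega> (x * H c w)" m]
      unfolding sum_distrib_left[symmetric] sum_unit_character[OF p] by (rule arg_cong)
  qed
  \<comment> \<open>By independence, a nontrivial combination \<open>c\<close> has a column
    \<open>w\<close> with \<open>H c w\<close> not divisible by \<open>p\<close>, and the factor of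
    that column vanishes.\<close>
  also have "\<dots> = (\<Sum>c\<in>?G. if c = z then of_nat p ^ m else 0)"
  proof (intro sum.cong refl)
    fix c assume c: "c \<in> ?G"
    show "?\<omega> (K c) * (\<Prod>w<m. of_nat p * of_bool (p dvd H c w)) = (if c = z then of_nat p ^ m else 0)"
    proof (cases "c = z")
      case True
      then have "K c = 0" "H c w = 0" for w by (simp_all add: K_def H_def z_def)
      then show ?thesis using True by (simp add: unit_character_0)
    next
      case False
      have "\<not> (\<forall>w<m. p dvd H c w)"
      proof
        assume "\<forall>w<m. p dvd H c w"
        then have "\<forall>i\<in>I. c i = 0" using indep[OF c] by (simp add: H_def)
        then have "c = z" using c unfolding z_def
          by (intro ext) (auto simp: restrict_def PiE_arb[OF c])
        then show False using False by simp
      qed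
      then show ?thesis using False by (auto simp: pob)
    qed
  qed
  also have "\<dots> = of_nat (p ^ m)"
  proof -
    have "z \<in> ?G" using p by (auto simp: z_def)
    then show ?thesis using G by (simp add: sum.delta)
  qed
  finally show ?thesis unfolding Y_def of_nat_eq_iff .
qed

lemma sum_lessThan_add:
  fixes f :: "nat \<Rightarrow> 'a :: comm_monoid_add"
  shows "(\<Sum>w<m + k. f w) = (\<Sum>w<m. f w) + (\<Sum>w<k. f (m + w))"
  by (induction k) (simp_all add: add.assoc)

text \<open>Within a block of \<open>p ^ m\<close> indices only the low digits vary: each output
  digit is a linear form in them plus a term depending on \<open>k\<close> alone. The range
  \<open>w < k\<close> covers all nonzero digits of \<open>k\<close>.\<close>

lemma digital_digit_block:
  assumes p: "p \<ge> 2" and l: "l < p ^ m"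
  shows "digital_digit p M (k * p ^ m + l) v
     = ((\<Sum>w<m. M v w * digit p l w) + (\<Sum>w<k. M v (m + w) * digit p k w)) mod p"
proof -
  have p0: "p > 0" using p by simp
  have "w < m + k" if "digit p (k * p ^ m + l) w \<noteq> 0" for w
  proof (rule ccontr)
    assume "\<not> w < m + k"
    then have u: "m + (w - m) = w" "k \<le> w - m" by simp_all
    then show False using that digit_block_high[OF p0 l, of k "w - m"] digit_eq_0[OF p u(2)] u(1) by simp
  qed
  then have "(\<Sum>w | digit p (k * p ^ m + l) w \<noteq> 0. M v w * digit p (k * p ^ m + l) w)
      = (\<Sum>w<m + k. M v w * digit p (k * p ^ m + l) w)"
    by (intro sum.mono_neutral_left subsetI) simp_all
  also have "\<dots> = (\<Sum>w<m. M v w * digit p l w) + (\<Sum>w<k. M v (m + w) * digit p k w)"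
    unfolding sum_lessThan_add
    by (intro arg_cong2[of _ _ _ _ "(+)"] sum.cong refl)
       (simp_all only: lessThan_iff digit_block_low[OF p0] digit_block_high[OF p0 l])
  finally show ?thesis by (simp add: digital_digit_def)
qed

text \<open>Only finitely many columns meet a nonzero digit of \<open>n\<close>, and each column
  vanishes from some row on.\<close>

lemma digital_digit_eventually_0:
  assumes p: "p \<ge> 2" and M: "\<And>w. \<forall>\<^sub>F v in sequentially. M v w = 0"
  shows "\<forall>\<^sub>F v in sequentially. digital_digit p M n v = 0"
proof -
  have "{w. digit p n w \<noteq> 0} \<subseteq> {..<n}"
  proof
    fix w assume "w \<in> {w. digit p n w \<noteq> 0}"
    then have "\<not> n \<le> w" using digit_eq_0[OF p, of n w] by auto
    then show "w \<in> {..<n}" by simp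
  qed
  then have "finite {w. digit p n w \<noteq> 0}" by (rule finite_subset) simp
  then have "\<forall>\<^sub>F v in sequentially. \<forall>w\<in>{w. digit p n w \<noteq> 0}. M v w = 0"
    by (rule eventually_ball_finite) (simp add: M)
  then show ?thesis
  proof eventually_elim
    case (elim v)
    then have "(\<Sum>w | digit p n w \<noteq> 0. M v w * digit p n w) = 0" by (intro sum.neutral) simp
    then show ?case by (simp add: digital_digit_def)
  qed
qed

lemma digital_sequence_nth: "digital_sequence p C n $ j = digit_value p (digital_digit p (C j) n)"
  by (simp add: digital_sequence_def digit_value_def)

text \<open>An elementary interval imposes one affine equation per prescribed digit. The equations
  have independent linear parts in the \<open>m\<close> low digits of the index, so every block of
  \<open>p ^ m\<close> indices contains exactly \<open>p ^ t\<close> solutions.\<close>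

lemma elementary_count_bound_digital:
  fixes C :: "'s::finite \<Rightarrow> nat \<Rightarrow> nat \<Rightarrow> nat"
  assumes p: "p \<ge> 2" and C: "digital_ts_matrices p t C"
  shows "elementary_count_bound (\<lambda>_. p) (real p ^ t) (digital_sequence p C)"
  unfolding elementary_count_bound_def
proof (intro allI impI)
  fix d a :: "'s \<Rightarrow> nat" and N
  assume a: "\<forall>j. a j < p ^ d j"
  have p0: "p > 0" using p by simp
  \<comment> \<open>With this choice the \<open>d j\<close> add up to \<open>m - t\<close>, the case
    in which the matrices guarantee independence.\<close>
  define m where "m = t + (\<Sum>j\<in>UNIV. d j)"
  define I where "I = (SIGMA j:UNIV. {..<d j})"
  have I: "finite I" "card I = (\<Sum>j\<in>UNIV. d j)" by (simp_all add: I_def)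
  have ev: "\<forall>\<^sub>F v in sequentially. C j v w = 0" for j w
    using C by (simp add: digital_ts_matrices_def)
  have "\<exists>e. (\<forall>i<d j. e i < p) \<and> (\<forall>n. \<lfloor>real p ^ d j * digital_sequence p C n $ j\<rfloor> = int (a j) \<longleftrightarrow>
      (\<forall>i<d j. digital_digit p (C j) n i = e i))" for j
  proof -
    obtain e where e: "\<And>i. i < d j \<Longrightarrow> e i < p"
      "\<And>g. \<lbrakk>\<forall>i. g i < p; \<forall>\<^sub>F i in sequentially. g i = 0\<rbrakk> \<Longrightarrow>
        \<lfloor>real p ^ d j * digit_value p g\<rfloor> = int (a j) \<longleftrightarrow> (\<forall>i<d j. g i = e i)"
      using floor_digit_value_eq_iff[OF a[rule_format, of j] p0] by (elim exE conjE) blast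
    have "digital_digit p (C j) n i < p" for n i using p0 by (simp add: digital_digit_def)
    then have "\<lfloor>real p ^ d j * digital_sequence p C n $ j\<rfloor> = int (a j) \<longleftrightarrow>
      (\<forall>i<d j. digital_digit p (C j) n i = e i)" for n
      unfolding digital_sequence_nth using digital_digit_eventually_0[OF p ev] by (intro e(2)) auto
    then show ?thesis using e(1) by blast
  qed
  then obtain e where e: "\<And>j i. i < d j \<Longrightarrow> e j i < p"
    "\<And>n j. \<lfloor>real p ^ d j * digital_sequence p C n $ j\<rfloor> = int (a j) \<longleftrightarrow>
      (\<forall>i<d j. digital_digit p (C j) n i = e j i)"
    by metis
  have blk: "card {l. l < p ^ m \<and>
      (\<forall>j. \<lfloor>real p ^ d j * digital_sequence p C (k * p ^ m + l) $ j\<rfloor> = int (a j))} = p ^ t" for k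
  proof -
    define M where "M i w = C (fst i) (snd i) w" for i w
    \<comment> \<open>contribution of the digits of \<open>k\<close>, minus the prescribed digit modulo \<open>p\<close>\<close>
    define \<kappa> where "\<kappa> i = (\<Sum>w<k. C (fst i) (snd i) (m + w) * digit p k w) + (p - e (fst i) (snd i))" for i
    have dd: "digital_digit p (C j) (k * p ^ m + l) v = e j v \<longleftrightarrow>
        p dvd (\<Sum>w<m. M (j, v) w * digit p l w) + \<kappa> (j, v)"
      if "v < d j" "l < p ^ m" for j v l
    proof -
      \<comment> \<open>Adding \<open>p - e j v\<close> stands for subtracting the prescribed digit
        and stays in the natural numbers, since \<open>e j v < p\<close>.\<close>
      have "X mod p = e j v \<longleftrightarrow> p dvd X + (p - e j v)" for X
      proof -
        have "p dvd X + (p - e j v) \<longleftrightarrow> p dvd int X - int (e j v) + int p"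
          using e(1)[OF that(1)] by (simp add: of_nat_diff algebra_simps flip: int_dvd_int_iff)
        also have "\<dots> \<longleftrightarrow> p dvd int X - int (e j v)" by (simp add: dvd_add_left_iff)
        also have "\<dots> \<longleftrightarrow> int X mod p = int (e j v) mod p" by (rule mod_eq_dvd_iff[symmetric])
        also have "\<dots> \<longleftrightarrow> X mod p = e j v"
          using e(1)[OF that(1)] by (simp flip: of_nat_mod)
        finally show ?thesis by simp
      qed
      from this[of "(\<Sum>w<m. M (j, v) w * digit p l w) + (\<Sum>w<k. C j v (m + w) * digit p k w)"]
      show ?thesis
        unfolding digital_digit_block[OF p that(2)] by (simp add: M_def \<kappa>_def add.assoc)
    qed
    have "(\<forall>j. \<lfloor>real p ^ d j * digital_sequence p C (k * p ^ m + l) $ j\<rfloor> = int (a j)) \<longleftrightarrow>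
        (\<forall>i\<in>I. p dvd (\<Sum>w<m. M i w * digit p l w) + \<kappa> i)" if "l < p ^ m" for l
      unfolding e(2) using dd[OF _ that] by (auto simp: I_def)
    then have eq: "{l. l < p ^ m \<and>
      (\<forall>j. \<lfloor>real p ^ d j * digital_sequence p C (k * p ^ m + l) $ j\<rfloor> = int (a j))}
      = {l. l < p ^ m \<and> (\<forall>i\<in>I. p dvd (\<Sum>w<m. M i w * digit p l w) + \<kappa> i)}" by blast
    have "card {l. l < p ^ m \<and> (\<forall>i\<in>I. p dvd (\<Sum>w<m. M i w * digit p l w) + \<kappa> i)} * p ^ card I = p ^ m"
    proof (rule linear_system_count[OF p0 I(1)])
      fix c assume c: "c \<in> I \<rightarrow>\<^sub>E {..<p}" and dv: "\<forall>w<m. p dvd (\<Sum>i\<in>I. c i * M i w)"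
      have "\<forall>c. (\<forall>j. \<forall>v<d j. c j v < p) \<longrightarrow>
           (\<forall>w<m. (\<Sum>j\<in>UNIV. \<Sum>v<d j. c j v * C j v w) mod p = 0) \<longrightarrow>
           (\<forall>j. \<forall>v<d j. c j v = 0)"
        using C[unfolded digital_ts_matrices_def, THEN conjunct2, THEN conjunct1, THEN spec[of _ m], THEN spec[of _ d]]
        by (simp add: m_def)
      from this[rule_format, of "\<lambda>j v. c (j, v)"]
      have "(\<forall>j. \<forall>v<d j. c (j, v) < p) \<Longrightarrow>
           (\<forall>w<m. (\<Sum>j\<in>UNIV. \<Sum>v<d j. c (j, v) * C j v w) mod p = 0) \<Longrightarrow>
           (\<forall>j. \<forall>v<d j. c (j, v) = 0)" by blast
      moreover have "\<forall>j. \<forall>v<d j. c (j, v) < p"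
        using c by (auto simp: I_def dest!: PiE_mem)
      moreover have "(\<Sum>j\<in>UNIV. \<Sum>v<d j. c (j, v) * C j v w) = (\<Sum>i\<in>I. c i * M i w)" for w
        unfolding I_def M_def by (subst sum.Sigma) (auto intro: sum.cong)
      ultimately show "\<forall>i\<in>I. c i = 0" using dv by (auto simp: I_def dvd_eq_mod_eq_0)
    qed
    then show ?thesis unfolding eq using p0 by (simp add: m_def power_add I(2))
  qed
  have "p ^ m > 0" using p0 by simp
  from block_count_error[OF this blk, of N]
  have "\<bar>real (card {n. n < N \<and> (\<forall>j. \<lfloor>real p ^ d j * digital_sequence p C n $ j\<rfloor> = int (a j))})
      - real N * real (p ^ t) / real (p ^ m)\<bar> \<le> real (p ^ t)" .
  moreover have "real N * real (p ^ t) / real (p ^ m) = real N / (\<Prod>j\<in>UNIV. real p ^ d j)"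
    using p0 by (simp add: m_def power_add power_sum)
  ultimately show "\<bar>real (card {n. n < N \<and> (\<forall>j. \<lfloor>real p ^ d j * digital_sequence p C n $ j\<rfloor> = int (a j))})
      - real N / (\<Prod>j\<in>UNIV. real p ^ d j)\<bar> \<le> real p ^ t" by simp
qed

lemma range_digital_sequence_subset:
  fixes C :: "'s::finite \<Rightarrow> nat \<Rightarrow> nat \<Rightarrow> nat"
  assumes p: "p \<ge> 2" and C: "digital_ts_matrices p t C"
  shows "range (digital_sequence p C) \<subseteq> unit_cube"
proof -
  have "digital_digit p (C j) n i < p" for n i j using p by (simp add: digital_digit_def)
  moreover have "\<forall>\<^sub>F v in sequentially. digital_digit p (C j) n v = 0" for j n
    using C by (intro digital_digit_eventually_0[OF p]) (simp add: digital_ts_matrices_def)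
  ultimately show ?thesis using digit_value_bounds
    by (auto simp: unit_cube_def half_open_box_def digital_sequence_nth)
qed

subsection \<open>Repeating the points of a sequence\<close>

lemma box_error_eq_sum:
  "box_error x B N = (\<Sum>n<N. of_bool (x n \<in> B) - measure lborel B)"
  by (simp add: box_error_def card_eq_sum_of_bool sum_subtractf)

text \<open>For \<open>N \<ge> 2\<close>, \<open>N + a \<le> N ^ (a + 1)\<close>. This absorbs the
  shift by \<open>A\<close> in the range of \<open>f\<close> into a constant factor.\<close>

lemma ln_add_le:
  assumes "N \<ge> (2::nat)"
  shows "ln (real (N + a)) \<le> real (a + 1) * ln (real N)"
proof -
  have "N + a \<le> N * 2 ^ a"
  proof (induction a)
    case (Suc a)
    have "1 \<le> N * 2 ^ a" using assms by simp
    then show ?case using Suc by simp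
  qed simp
  also have "\<dots> \<le> N * N ^ a" using assms by (intro mult_left_mono power_mono) auto
  finally have "real (N + a) \<le> real N ^ (a + 1)"
    unfolding of_nat_power[symmetric] of_nat_le_iff by simp
  then have "ln (real (N + a)) \<le> ln (real N ^ (a + 1))"
    using assms by (subst ln_le_cancel_iff) auto
  also have "\<dots> = real (a + 1) * ln (real N)" using assms by (intro ln_realpow)
  finally show ?thesis .
qed

text \<open>Abel summation. The boundary term stays on the left, so the right side involves only the
  bound on partial sums and the total variation of the weights.\<close>

lemma summation_by_parts_bound:
  fixes g G :: "nat \<Rightarrow> real"
  assumes \<Delta>: "\<And>k. k \<le> M \<Longrightarrow> \<bar>\<Sum>j<k. g j\<bar> \<le> D"
  shows "\<bar>(\<Sum>k<M. G k * g k) - G M * (\<Sum>k<M. g k)\<bar> \<le> D * (\<Sum>k<M. \<bar>G (Suc k) - G k\<bar>)"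
proof -
  have "(\<Sum>k<M. G k * g k) - G M * (\<Sum>k<M. g k) = (\<Sum>k<M. (G k - G (Suc k)) * (\<Sum>j<Suc k. g j))"
    by (induction M) (simp_all add: algebra_simps)
  also have "\<bar>\<dots>\<bar> \<le> (\<Sum>k<M. \<bar>(G k - G (Suc k)) * (\<Sum>j<Suc k. g j)\<bar>)" by (rule sum_abs)
  also have "\<dots> \<le> (\<Sum>k<M. \<bar>G (Suc k) - G k\<bar> * D)"
  proof (rule sum_mono)
    fix k assume "k \<in> {..<M}"
    then have "\<bar>\<Sum>j<Suc k. g j\<bar> \<le> D" by (intro \<Delta>) auto
    then show "\<bar>(G k - G (Suc k)) * (\<Sum>j<Suc k. g j)\<bar> \<le> \<bar>G (Suc k) - G k\<bar> * D"
      unfolding abs_mult abs_minus_commute[of "G k"] by (rule mult_left_mono) simp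
  qed
  finally show ?thesis by (simp add: sum_distrib_left mult.commute)
qed

text \<open>From \<open>K\<close> on the variation telescopes to \<open>G M - G K\<close>; the part
  before \<open>K\<close> is a constant independent of \<open>M\<close>.\<close>

lemma eventually_mono_variation_bound:
  fixes G :: "nat \<Rightarrow> real"
  assumes mono: "\<And>k. k \<ge> K \<Longrightarrow> G k \<le> G (Suc k)" and G0: "\<And>k. G k \<ge> 0"
  shows "(\<Sum>k<M. \<bar>G (Suc k) - G k\<bar>) \<le> (\<Sum>k<K. \<bar>G (Suc k) - G k\<bar>) + G M"
proof (cases "M \<le> K")
  case True
  then have "(\<Sum>k<M. \<bar>G (Suc k) - G k\<bar>) \<le> (\<Sum>k<K. \<bar>G (Suc k) - G k\<bar>)"
    by (intro sum_mono2) auto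
  then show ?thesis using G0[of M] by simp
next
  case False
  then obtain d where M: "M = K + d" using le_Suc_ex nat_le_linear by blast
  have "(\<Sum>k<K + d. \<bar>G (Suc k) - G k\<bar>) = (\<Sum>k<K. \<bar>G (Suc k) - G k\<bar>) + (G (K + d) - G K)"
    using mono by (induction d) auto
  then show ?thesis using G0[of K] by (simp add: M)
qed

section \<open>Levels of a monotone surjection and sums along it\<close>

context
  fixes A :: nat and f :: "nat \<Rightarrow> nat"
  assumes range_f: "range f = {A..}" and mono_f: "mono f"
begin

text \<open>Being onto, \<open>f\<close> takes a value above \<open>k\<close>; being monotone, it
  never returns to \<open>k\<close>. Hence the cardinality in \<open>level_count\<close> is a
  genuine count.\<close>

lemma finite_level: "finite {n. f n = k}"
proof -
  have "A + k + 1 \<in> range f" using range_f by simp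
  then obtain n0 where n0: "f n0 = A + k + 1" by auto
  have "n < n0" if "f n = k" for n
  proof (rule ccontr)
    assume "\<not> n < n0"
    then have "f n0 \<le> f n" using monoD[OF mono_f] by simp
    then show False using n0 that by simp
  qed
  then have "{n. f n = k} \<subseteq> {..<n0}" by auto
  then show ?thesis by (rule finite_subset) simp
qed

lemma level_count_pos: "k \<ge> A \<Longrightarrow> level_count f (int k) > 0"
proof -
  assume "k \<ge> A"
  then have "k \<in> range f" using range_f by simp
  then have "{n. f n = k} \<noteq> {}" by auto
  then show ?thesis using finite_level[of k] by (simp add: level_count_def card_gt_0_iff)
qed

text \<open>A monotone surjection skips no value: all values in \<open>{A..<f n}\<close> are
  attained at indices below \<open>n\<close>.\<close>

lemma le_add_index: "f n \<le> A + n"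
proof -
  have "{A..<f n} \<subseteq> f ` {..<n}"
  proof
    fix k assume k: "k \<in> {A..<f n}"
    then have "k \<in> range f" using range_f by simp
    then obtain i where i: "k = f i" by auto
    have "i < n"
    proof (rule ccontr)
      assume "\<not> i < n"
      then have "f n \<le> f i" using monoD[OF mono_f] by simp
      then show False using k i by simp
    qed
    then show "k \<in> f ` {..<n}" using i by auto
  qed
  then have "card {A..<f n} \<le> card (f ` {..<n})" by (intro card_mono) auto
  also have "\<dots> \<le> n" using card_image_le[of "{..<n}" f] by simp
  finally show ?thesis by simp
qed

text \<open>Indices are grouped by their value under \<open>f\<close>. By monotonicity every level
  below \<open>f (N - 1)\<close> is complete, and only the last one may be cut off; \<open>w\<close>
  is the number of its indices below \<open>N\<close>.\<close>

lemma sum_compose_by_levels: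
  fixes g :: "nat \<Rightarrow> real"
  assumes N: "N \<ge> 1"
  shows "\<exists>w\<ge>0. w \<le> real (level_count f (int (f (N - 1)))) \<and>
    (\<Sum>n<N. g (f n)) = (\<Sum>k<f (N - 1). real (level_count f (int k)) * g k) + w * g (f (N - 1))"
proof -
  define M where "M = f (N - 1)"
  define w where "w k = card {n. n < N \<and> f n = k}" for k
  have fM: "f n \<le> M" if "n < N" for n
    unfolding M_def using that by (intro monoD[OF mono_f]) simp
  have "(\<Sum>n<N. g (f n)) = (\<Sum>k<Suc M. \<Sum>n | n \<in> {..<N} \<and> f n = k. g (f n))"
    using fM by (intro sum.group[symmetric]) (auto simp: less_Suc_eq_le)
  also have "\<dots> = (\<Sum>k<Suc M. real (w k) * g k)"
    by (intro sum.cong refl) (simp add: w_def)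
  also have "\<dots> = (\<Sum>k<M. real (level_count f (int k)) * g k) + real (w M) * g M"
  proof -
    have "w k = level_count f (int k)" if "k < M" for k
    proof -
      have "n < N" if "f n = k" for n
      proof (rule ccontr)
        assume "\<not> n < N"
        then have "M \<le> f n" unfolding M_def by (intro monoD[OF mono_f]) simp
        then show False using that \<open>k < M\<close> by simp
      qed
      then have "{n. n < N \<and> f n = k} = {n. int (f n) = int k}" by auto
      then show ?thesis by (simp add: w_def level_count_def)
    qed
    then show ?thesis by simp
  qed
  finally have "(\<Sum>n<N. g (f n)) = (\<Sum>k<M. real (level_count f (int k)) * g k) + real (w M) * g M" .
  moreover have "w M \<le> level_count f (int M)"
    unfolding w_def level_count_def using finite_level[of M] by (intro card_mono) auto
  ultimately show ?thesis unfolding M_def by (intro exI[of _ "real (w (f (N - 1)))"]) simp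
qed

text \<open>Summation by parts with the level counts as weights. The constant is chosen before
  \<open>D\<close> and \<open>g\<close>, hence serves all boxes at once.\<close>

lemma composed_sum_bound:
  assumes mono_F: "mono_on {K..} (level_count f)"
  shows "\<exists>c\<ge>0. \<forall>N\<ge>1. \<forall>D g. (\<forall>k\<le>Suc (f (N - 1)). \<bar>\<Sum>j<k. g j :: real\<bar> \<le> D) \<longrightarrow>
    \<bar>\<Sum>n<N. g (f n)\<bar> \<le> D * (c * real (level_count f (int (f (N - 1)) + 1)))"
proof -
  define G where "G k = real (level_count f (int k))" for k
  have G0: "G k \<ge> 0" for k by (simp add: G_def)
  have G_mono: "G k \<le> G (Suc k)" if "k \<ge> nat K" for k
    unfolding G_def using that by (intro of_nat_mono mono_onD[OF mono_F]) auto
  define V where "V = (\<Sum>k<nat K. \<bar>G (Suc k) - G k\<bar>)"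
  \<comment> \<open>\<open>H\<close> bounds \<open>G M\<close> for small \<open>M\<close>, where
    \<open>G M \<le> G (Suc M)\<close> may fail.\<close>
  define H where "H = (\<Sum>k<nat K. G k)"
  have V0: "V \<ge> 0" and H0: "H \<ge> 0" using G0 by (auto simp: V_def H_def intro!: sum_nonneg)
  show ?thesis
  proof (intro exI[of _ "V + 4 * (H + 1)"] conjI allI impI)
    show "V + 4 * (H + 1) \<ge> 0" using V0 H0 by simp
    fix N :: nat and D :: real and g :: "nat \<Rightarrow> real"
    assume N: "1 \<le> N" and \<Delta>: "\<forall>k\<le>Suc (f (N - 1)). \<bar>\<Sum>j<k. g j\<bar> \<le> D"
    define M where "M = f (N - 1)"
    have \<Delta>: "\<bar>\<Sum>j<k. g j\<bar> \<le> D" if "k \<le> Suc M" for k using \<Delta> that by (auto simp: M_def)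
    have D0: "D \<ge> 0" using \<Delta>[of 0] by simp
    obtain w where w: "0 \<le> w" "w \<le> G M" "(\<Sum>n<N. g (f n)) = (\<Sum>k<M. G k * g k) + w * g M"
      using sum_compose_by_levels[OF N, of g] unfolding G_def M_def by blast
    have "A \<le> f n" for n
      using range_f by (metis atLeast_iff rangeI)
    then have "G (Suc M) > 0" unfolding G_def M_def
      using level_count_pos[of "Suc (f (N - 1))"] by (simp add: le_SucI)
    \<comment> \<open>Level \<open>Suc M\<close> is attained, so the constants \<open>V\<close> and
      \<open>H\<close> can be absorbed into multiples of \<open>G (Suc M)\<close>.\<close>
    then have G1: "G (Suc M) \<ge> 1" unfolding G_def by simp
    have "G M \<le> H + G (Suc M)"
    proof (cases "nat K \<le> M")
      case True
      then show ?thesis using G_mono[of M] H0 by simp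
    next
      case False
      then have "G M \<le> H" unfolding H_def using G0 by (intro member_le_sum) auto
      then show ?thesis using G0[of "Suc M"] by simp
    qed
    also have "\<dots> \<le> (H + 1) * G (Suc M)"
      using mult_left_mono[OF G1 H0] by (simp add: algebra_simps)
    finally have GM: "G M \<le> (H + 1) * G (Suc M)" .
    have "\<bar>(\<Sum>k<M. G k * g k) - G M * (\<Sum>k<M. g k)\<bar> \<le> D * (\<Sum>k<M. \<bar>G (Suc k) - G k\<bar>)"
      by (rule summation_by_parts_bound) (simp add: \<Delta>)
    also have "\<dots> \<le> D * (V + G M)"
      unfolding V_def using eventually_mono_variation_bound[of "nat K" G, OF G_mono G0] D0
      by (intro mult_left_mono) auto
    finally have 1: "\<bar>(\<Sum>k<M. G k * g k) - G M * (\<Sum>k<M. g k)\<bar> \<le> D * (V + G M)" .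
    have 2: "\<bar>G M * (\<Sum>k<M. g k)\<bar> \<le> G M * D"
      unfolding abs_mult using G0[of M] \<Delta>[of M] by (intro mult_mono) auto
    \<comment> \<open>A single term is a difference of consecutive partial sums; this is where the
      bound at \<open>Suc M\<close> is used.\<close>
    have "\<bar>g M\<bar> \<le> 2 * D" using \<Delta>[of M] \<Delta>[of "Suc M"] by simp
    then have 3: "\<bar>w * g M\<bar> \<le> G M * (2 * D)"
      unfolding abs_mult using w D0 by (intro mult_mono) auto
    have "\<bar>\<Sum>n<N. g (f n)\<bar> \<le> D * (V + G M) + G M * D + G M * (2 * D)"
      unfolding w(3) using 1 2 3 by linarith
    also have "\<dots> = D * (V + 4 * G M)" by (simp add: algebra_simps)
    also have "\<dots> \<le> D * ((V + 4 * (H + 1)) * G (Suc M))"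
    proof (rule mult_left_mono[OF _ D0])
      have "V \<le> V * G (Suc M)" using mult_left_mono[OF G1 V0] by simp
      then show "V + 4 * G M \<le> (V + 4 * (H + 1)) * G (Suc M)"
        using GM by (simp add: algebra_simps)
    qed
    also have "G (Suc M) = real (level_count f (int (f (N - 1)) + 1))"
      by (simp add: G_def M_def add.commute)
    finally show "\<bar>\<Sum>n<N. g (f n)\<bar> \<le>
      D * ((V + 4 * (H + 1)) * real (level_count f (int (f (N - 1)) + 1)))" .
  qed
qed

text \<open>For a fixed box, \<open>composed_sum_bound\<close> is applied to indicator minus volume,
  whose partial sums are values of \<open>box_error\<close>.\<close>

lemma discrepancy_composed_bound:
  fixes b :: "'s::finite \<Rightarrow> nat" and x :: "nat \<Rightarrow> real ^ 's"
  assumes mono_F: "mono_on {K..} (level_count f)"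
    and x: "elementary_count_bound b R x" "range x \<subseteq> unit_cube" and b: "\<And>j. b j \<ge> 2"
  shows "\<exists>C\<ge>0. \<forall>N\<ge>2. discrepancy N (\<lambda>n. x (f n))
    \<le> C * (real (level_count f (int (f (N - 1)) + 1)) * ln (real N) ^ CARD('s) / real N)"
proof -
  obtain C where C: "C \<ge> 0" "\<forall>N\<ge>2. \<forall>k\<le>N. \<forall>\<alpha> \<beta>. half_open_box \<alpha> \<beta> \<subseteq> unit_cube \<longrightarrow>
    \<bar>box_error x (half_open_box \<alpha> \<beta>) k\<bar> \<le> C * ln (real N) ^ CARD('s)"
    using box_error_bound[OF x b] by (elim exE conjE) (rule that)
  obtain c where c: "c \<ge> 0"
    "\<forall>N\<ge>1. \<forall>D g. (\<forall>k\<le>Suc (f (N - 1)). \<bar>\<Sum>j<k. g j :: real\<bar> \<le> D) \<longrightarrow>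
      \<bar>\<Sum>n<N. g (f n)\<bar> \<le> D * (c * real (level_count f (int (f (N - 1)) + 1)))"
    using composed_sum_bound[OF mono_F] by (elim exE conjE) (rule that)
  define C' where "C' = C * real (A + 1) ^ CARD('s) * c"
  show ?thesis
  proof (intro exI[of _ C'] conjI allI impI)
    show "C' \<ge> 0" using C(1) c(1) by (simp add: C'_def)
    fix N :: nat assume N: "2 \<le> N"
    define P where "P = real (level_count f (int (f (N - 1)) + 1))"
    have bound: "\<bar>real (card {n. n < N \<and> x (f n) \<in> half_open_box \<alpha> \<beta>}) / real N
        - measure lborel (half_open_box \<alpha> \<beta>)\<bar> \<le> C' * (P * ln (real N) ^ CARD('s) / real N)"
      if sub: "half_open_box \<alpha> \<beta> \<subseteq> unit_cube" for \<alpha> \<beta>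
    proof -
      let ?B = "half_open_box \<alpha> \<beta>"
      have partial: "\<bar>\<Sum>j<k. of_bool (x j \<in> ?B) - measure lborel ?B\<bar> \<le> C * (real (A + 1) * ln (real N)) ^ CARD('s)"
        if k: "k \<le> Suc (f (N - 1))" for k
      proof -
        \<comment> \<open>Indeed \<open>f (N - 1) + 1 \<le> A + (N - 1) + 1\<close>, so only the
          first \<open>N + A\<close> points of \<open>x\<close> are involved.\<close>
        have "k \<le> N + A" using le_add_index[of "N - 1"] k N by simp
        then have "\<bar>box_error x ?B k\<bar> \<le> C * ln (real (N + A)) ^ CARD('s)"
          using N by (intro C(2)[rule_format] sub) simp_all
        also have "\<dots> \<le> C * (real (A + 1) * ln (real N)) ^ CARD('s)"
          using ln_add_le[OF N, of A] C(1) N by (intro mult_left_mono power_mono) auto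
        finally show ?thesis by (simp add: box_error_eq_sum)
      qed
      have "\<bar>\<Sum>n<N. of_bool (x (f n) \<in> ?B) - measure lborel ?B\<bar>
          \<le> C * (real (A + 1) * ln (real N)) ^ CARD('s) * (c * P)"
        unfolding P_def using N
        by (intro c(2)[THEN spec[of _ N], THEN mp, THEN spec, THEN spec[of _ "\<lambda>j. of_bool (x j \<in> ?B) - measure lborel ?B"], THEN mp]
              allI impI partial) simp_all
      also have "(\<Sum>n<N. of_bool (x (f n) \<in> ?B) - measure lborel ?B)
          = N * (real (card {n. n < N \<and> x (f n) \<in> ?B}) / real N - measure lborel ?B)"
        using N by (simp add: card_eq_sum_of_bool sum_subtractf right_diff_distrib)
      also have "C * (real (A + 1) * ln (real N)) ^ CARD('s) * (c * P)
          = N * (C' * (P * ln (real N) ^ CARD('s) / real N))"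
        using N by (simp add: C'_def power_mult_distrib)
      finally show ?thesis using N by (simp add: abs_mult pos_le_divide_eq mult.commute)
    qed
    \<comment> \<open>The empty box shows that the supremum is taken over a nonempty set.\<close>
    have "half_open_box 0 0 = ({} :: (real ^ 's) set)" by (auto simp: half_open_box_def not_less)
    then have "(0, 0) \<in> {(a, b). half_open_box a b \<subseteq> (unit_cube :: (real ^ 's) set)}" by simp
    then show "discrepancy N (\<lambda>n. x (f n))
      \<le> C' * (real (level_count f (int (f (N - 1)) + 1)) * ln (real N) ^ CARD('s) / real N)"
      unfolding discrepancy_def P_def[symmetric]
      by (intro cSUP_least) (blast, simp only: mem_Collect_eq case_prod_beta, erule bound)
  qed
qed

end

subsection \<open>The lower bound\<close>

lemma measure_half_open_box_le_1:
  assumes "half_open_box a b \<subseteq> unit_cube"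
  shows "measure lborel (half_open_box a b :: (real ^ 's::finite) set) \<le> 1"
proof (cases "half_open_box a b = {}")
  case False
  have "a $ i \<le> b $ i" for i using half_open_box_nonempty_imp_less[OF False, of i] by simp
  moreover from this have "(\<Prod>i\<in>UNIV. b $ i - a $ i) \<le> 1"
    using half_open_box_subset_unit_cubeD[OF assms False]
    by (intro prod_le_1) (auto simp: diff_le_eq intro: order_trans add_increasing2)
  ultimately show ?thesis by (simp add: measure_half_open_box)
qed simp

text \<open>Both the relative frequency and the volume lie in \<open>[0, 1]\<close>, so the set
  under the supremum is bounded and the supremum is a true upper bound.\<close>

lemma discrepancy_upper:
  fixes y :: "nat \<Rightarrow> real ^ 's::finite"
  assumes "half_open_box a b \<subseteq> unit_cube"
  shows "\<bar>real (card {n. n < N \<and> y n \<in> half_open_box a b}) / real N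
          - measure lborel (half_open_box a b)\<bar> \<le> discrepancy N y"
proof -
  have "bdd_above ((\<lambda>(a, b). \<bar>real (card {n. n < N \<and> y n \<in> half_open_box a b}) / real N
          - measure lborel (half_open_box a b)\<bar>) ` {(a, b). half_open_box a b \<subseteq> unit_cube})"
  proof (rule bdd_aboveI2[of _ _ 1], clarify)
    fix a b :: "real ^ 's" assume sub: "half_open_box a b \<subseteq> unit_cube"
    have "card {n. n < N \<and> y n \<in> half_open_box a b} \<le> card {..<N}"
      by (intro card_mono) auto
    then have "real (card {n. n < N \<and> y n \<in> half_open_box a b}) / real N \<le> 1"
      by (simp add: divide_le_eq)
    moreover have "real (card {n. n < N \<and> y n \<in> half_open_box a b}) / real N \<ge> 0" by simp
    ultimately show "\<bar>real (card {n. n < N \<and> y n \<in> half_open_box a b}) / real N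
          - measure lborel (half_open_box a b)\<bar> \<le> 1"
      using measure_half_open_box_le_1[OF sub] measure_nonneg[of lborel "half_open_box a b"]
      by linarith
  qed
  from cSUP_upper[OF _ this, of "(a, b)"] assms show ?thesis
    unfolding discrepancy_def by simp
qed

text \<open>A small cube with lower corner \<open>z\<close> contains all repetitions of
  \<open>z\<close>, while its volume can be made at most any given \<open>e > 0\<close>.\<close>

lemma point_multiplicity_le_discrepancy:
  fixes y :: "nat \<Rightarrow> real ^ 's::finite"
  assumes z: "z \<in> unit_cube" and S: "S \<subseteq> {n. n < N \<and> y n = z}"
  shows "real (card S) / real N \<le> discrepancy N y"
proof (rule field_le_epsilon)
  fix e :: real assume e: "e > 0"
  \<comment> \<open>Side length at most \<open>e\<close> to control the volume, and at most each
    \<open>1 - z $ i\<close> to stay inside the unit cube.\<close>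
  define \<delta> where "\<delta> = Min (insert e (range (\<lambda>i. 1 - z $ i)))"
  have z01: "0 \<le> z $ i" "z $ i < 1" for i using z by (auto simp: unit_cube_def half_open_box_def)
  have \<delta>0: "\<delta> > 0" unfolding \<delta>_def using e z01 by (subst Min_gr_iff) auto
  have \<delta>e: "\<delta> \<le> e" unfolding \<delta>_def by (rule Min_le) auto
  have \<delta>z: "\<delta> \<le> 1 - z $ i" for i unfolding \<delta>_def by (rule Min_le) auto
  define b where "b = (\<chi> i. z $ i + \<delta>)"
  have sub: "half_open_box z b \<subseteq> unit_cube"
  proof
    fix v assume v: "v \<in> half_open_box z b"
    have "0 \<le> v $ i \<and> v $ i < 1" for i
      using v z01(1)[of i] \<delta>z[of i] by (auto simp: half_open_box_def b_def dest!: spec[of _ i])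
    then show "v \<in> unit_cube" by (simp add: unit_cube_def half_open_box_def)
  qed
  have "measure lborel (half_open_box z b) = \<delta> ^ CARD('s)"
    using \<delta>0 by (subst measure_half_open_box) (auto simp: b_def)
  \<comment> \<open>There is at least one coordinate; evaluating at an arbitrary one gives
    \<open>\<delta> \<le> 1\<close>.\<close>
  also have "\<dots> \<le> \<delta> ^ 1"
    using \<delta>0 \<delta>z[of undefined] z01(1)[of undefined] by (intro power_decreasing) (auto simp: Suc_le_eq)
  finally have vol: "measure lborel (half_open_box z b) \<le> e" using \<delta>e by simp
  have "z \<in> half_open_box z b" using \<delta>0 by (simp add: half_open_box_def b_def)
  then have "card S \<le> card {n. n < N \<and> y n \<in> half_open_box z b}"
    using S by (intro card_mono) auto
  then have "real (card S) / real N \<le> real (card {n. n < N \<and> y n \<in> half_open_box z b}) / real N"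
    by (intro divide_right_mono) auto
  then show "real (card S) / real N \<le> discrepancy N y + e"
    using discrepancy_upper[OF sub, of N y] vol by linarith
qed

theorem theorem4:
  fixes A :: nat and f :: "nat \<Rightarrow> nat" and F :: "int \<Rightarrow> nat"
  assumes "range f = {A..}"
    and "mono f"
    and F_def: "F = level_count f"
    and "\<exists>K. mono_on {K..} F"
  shows "(\<forall>x :: nat \<Rightarrow> real ^ 's. range x \<subseteq> unit_cube \<longrightarrow>
            (\<forall>N\<ge>1. real (F (int (f N) - 1)) / real N \<le> discrepancy N (\<lambda>n. x (f n))))
       \<and> (\<forall>b :: 's \<Rightarrow> nat. (\<forall>i. b i \<ge> 2) \<longrightarrow> (\<forall>i j. i \<noteq> j \<longrightarrow> coprime (b i) (b j)) \<longrightarrow>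
            (\<exists>C :: real. \<forall>N\<ge>2. discrepancy N (\<lambda>n. halton b (f n))
               \<le> C * (2 * real (F (int (f (N - 1)) + 1)) * ln (real N) ^ CARD('s) / real N)))
       \<and> (\<forall>p t. \<forall>x :: nat \<Rightarrow> real ^ 's. prime p \<longrightarrow> digital_ts_sequence p t x \<longrightarrow>
            (\<exists>C :: real. \<forall>N\<ge>2. discrepancy N (\<lambda>n. x (f n))
               \<le> C * real p ^ t * (2 * real (F (int (f (N - 1)) + 1)) * ln (real N) ^ CARD('s) / real N)))"
proof (intro conjI allI impI)
  fix x :: "nat \<Rightarrow> real ^ 's" and N :: nat
  assume x: "range x \<subseteq> unit_cube" and "1 \<le> N"
  \<comment> \<open>By monotonicity the whole level just below \<open>f N\<close> precedes
    \<open>N\<close>. If \<open>f N = 0\<close>, the left side is empty; otherwise the truncated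
    difference \<open>f N - 1\<close> agrees with the integer one.\<close>
  have "{n. int (f n) = int (f N) - 1} \<subseteq> {n. n < N \<and> x (f n) = x (f N - 1)}"
  proof safe
    fix n assume n: "int (f n) = int (f N) - 1"
    show "n < N"
    proof (rule ccontr)
      assume "\<not> n < N"
      then have "f N \<le> f n" using monoD[OF assms(2)] by simp
      then show False using n by simp
    qed
    have "f n = f N - 1" using n by linarith
    then show "x (f n) = x (f N - 1)" by simp
  qed
  then show "real (F (int (f N) - 1)) / real N \<le> discrepancy N (\<lambda>n. x (f n))"
    unfolding F_def level_count_def using x by (intro point_multiplicity_le_discrepancy) auto
next
  fix b :: "'s \<Rightarrow> nat"
  assume b: "\<forall>i. b i \<ge> 2" and cop: "\<forall>i j. i \<noteq> j \<longrightarrow> coprime (b i) (b j)"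
  obtain K where K: "mono_on {K..} (level_count f)" using assms(4) F_def by auto
  obtain C where "\<And>N. N \<ge> 2 \<Longrightarrow> discrepancy N (\<lambda>n. halton b (f n))
      \<le> C * (real (F (int (f (N - 1)) + 1)) * ln (real N) ^ CARD('s) / real N)"
    using discrepancy_composed_bound[OF assms(1,2) K elementary_count_bound_halton range_halton_subset, of b]
      b cop unfolding F_def by blast
  then show "\<exists>C. \<forall>N\<ge>2. discrepancy N (\<lambda>n. halton b (f n))
      \<le> C * (2 * real (F (int (f (N - 1)) + 1)) * ln (real N) ^ CARD('s) / real N)"
    by (intro exI[of _ "C / 2"]) simp
next
  fix p t and x :: "nat \<Rightarrow> real ^ 's"
  assume "prime p" and "digital_ts_sequence p t x"
  then obtain M where M: "digital_ts_matrices p t M" "x = digital_sequence p M" and p: "p \<ge> 2"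
    using prime_ge_2_nat by (auto simp: digital_ts_sequence_def)
  obtain K where K: "mono_on {K..} (level_count f)" using assms(4) F_def by auto
  obtain C where "\<And>N. N \<ge> 2 \<Longrightarrow> discrepancy N (\<lambda>n. x (f n))
      \<le> C * (real (F (int (f (N - 1)) + 1)) * ln (real N) ^ CARD('s) / real N)"
    using discrepancy_composed_bound[OF assms(1,2) K elementary_count_bound_digital[OF p M(1)]
        range_digital_sequence_subset[OF p M(1)] p]
    unfolding F_def M(2) by blast
  then show "\<exists>C. \<forall>N\<ge>2. discrepancy N (\<lambda>n. x (f n))
      \<le> C * real p ^ t * (2 * real (F (int (f (N - 1)) + 1)) * ln (real N) ^ CARD('s) / real N)"
    \<comment> \<open>\<open>C\<close> may depend on \<open>p\<close> and \<open>t\<close> but not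
      on \<open>N\<close>; dividing by \<open>2 * real p ^ t\<close> brings the bound into the
      stated form.\<close>
    using p by (intro exI[of _ "C / (2 * real p ^ t)"]) simp
qed

end
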